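(* Let $1\le q\le 2$ and $1/q'=1-1/q$. Then $$\mathcal E_q(t)\approx|\log t|^{1/q'},\qquad 0<t\le 1/2,$$ where $\mathcal E_q(t)=\sup\{f^*(t):\ \|f\|_{B^\infty_{0,q}}\le 1\}$; that is, there are constants $0<c\le C<\infty$ independent of $t$ with $c|\log t|^{1/q'}\le\mathcal E_q(t)\le C|\log t|^{1/q'}$ for all $0<t\le1/2$.
   Context: $\mathbb T=\mathbb R/\mathbb Z$, identified with $[0,1)$ with Lebesgue measure; functions on $\mathbb T$ are $1$-periodic functions on $\mathbb R$. $f^*$ denotes the nonincreasing rearrangement of $f$ (with respect to Lebesgue measure on $\mathbb T$). For $q=1$, $1/q'=0$. Fix an even $C^\infty$ function $\Phi=\phi_0$ on $\mathbb R$ with $\Phi(s)=1$ for $|s|\le 1$ and $\Phi$ supported in $(-2,2)$. For $k\ge1$ set $\phi_k(s)=\Phi(2^{-k}s)-\Phi(2^{-k+1}s)$. For a periodic distribution $f$ with Fourier coefficients $\widehat f(n)$ set $L_kf(x)=\sum_{n\in\mathbb Z}\phi_k(n)\widehat f(n)e^{2\pi i n x}$, $k\ge0$. The space $B^\infty_{0,q}=B^\infty_{0,q}(\mathbb T)$ consists of all periodic distributions $f$ with $\|f\|_{B^\infty_{0,q}}=\big(\sum_{k=0}^\infty\|L_kf\|_\infty^q\big)^{1/q}<\infty$. (The space does not depend on the choice of $\Phi$; for $q\le2$ its elements are locally integrable functions.) *)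

theory Defs
  imports "HOL-Analysis.Analysis"
begin

definition nth_vector_deriv :: "nat \<Rightarrow> (real \<Rightarrow> 'a::real_normed_vector) \<Rightarrow> real \<Rightarrow> 'a" where
  "nth_vector_deriv n f = ((\<lambda>g x. vector_derivative g (at x)) ^^ n) f"

definition smooth :: "(real \<Rightarrow> 'a::real_normed_vector) \<Rightarrow> bool" where
  "smooth f \<longleftrightarrow> (\<forall>n x. nth_vector_deriv n f differentiable (at x))"

definition periodic1 :: "(real \<Rightarrow> 'a) \<Rightarrow> bool" where
  "periodic1 f \<longleftrightarrow> (\<forall>x. f (x + 1) = f x)"

definition test_function :: "(real \<Rightarrow> complex) \<Rightarrow> bool" where
  "test_function \<psi> \<longleftrightarrow> smooth \<psi> \<and> periodic1 \<psi>"

(* A periodic distribution is a linear functional on the smooth 1-periodic functions that is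
   continuous for the seminorms sup |D^j \<psi>|.  Its values outside the test functions are
   irrelevant. *)
definition periodic_distribution :: "((real \<Rightarrow> complex) \<Rightarrow> complex) \<Rightarrow> bool" where
  "periodic_distribution u \<longleftrightarrow>
     (\<forall>\<psi> \<eta>. test_function \<psi> \<longrightarrow> test_function \<eta> \<longrightarrow> u (\<lambda>x. \<psi> x + \<eta> x) = u \<psi> + u \<eta>) \<and>
     (\<forall>a \<psi>. test_function \<psi> \<longrightarrow> u (\<lambda>x. a * \<psi> x) = a * u \<psi>) \<and>
     (\<exists>(C::real) N. \<forall>\<psi>. test_function \<psi> \<longrightarrow>
        norm (u \<psi>) \<le> C * (\<Sum>j\<le>N. SUP x. norm (nth_vector_deriv j \<psi> x)))"

definition fourier_coeff :: "((real \<Rightarrow> complex) \<Rightarrow> complex) \<Rightarrow> int \<Rightarrow> complex" where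
  "fourier_coeff u n = u (\<lambda>x. exp (- 2 * of_real pi * \<i> * of_int n * of_real x))"

(* The support is a closed set, so support in the open interval (-2,2) is a condition on the
   closure. *)
definition admissible_cutoff :: "(real \<Rightarrow> real) \<Rightarrow> bool" where
  "admissible_cutoff \<Phi> \<longleftrightarrow>
     smooth \<Phi> \<and> (\<forall>s. \<Phi> (- s) = \<Phi> s) \<and> (\<forall>s. \<bar>s\<bar> \<le> 1 \<longrightarrow> \<Phi> s = 1) \<and>
     closure {s. \<Phi> s \<noteq> 0} \<subseteq> {-2<..<2}"

primrec LP_multiplier :: "(real \<Rightarrow> real) \<Rightarrow> nat \<Rightarrow> real \<Rightarrow> real" where
  "LP_multiplier \<Phi> 0 s = \<Phi> s"
| "LP_multiplier \<Phi> (Suc k) s = \<Phi> (s / 2 ^ Suc k) - \<Phi> (s / 2 ^ k)"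

(* For an admissible cutoff only finitely many summands are nonzero. *)
definition LP_block ::
  "(real \<Rightarrow> real) \<Rightarrow> nat \<Rightarrow> ((real \<Rightarrow> complex) \<Rightarrow> complex) \<Rightarrow> real \<Rightarrow> complex" where
  "LP_block \<Phi> k u x =
     (\<Sum>\<^sub>\<infinity>n::int. of_real (LP_multiplier \<Phi> k (of_int n)) * fourier_coeff u n *
        exp (2 * of_real pi * \<i> * of_int n * of_real x))"

(* L_k u is a trigonometric polynomial, so its essential supremum is a supremum. *)
definition LP_block_norm :: "(real \<Rightarrow> real) \<Rightarrow> nat \<Rightarrow> ((real \<Rightarrow> complex) \<Rightarrow> complex) \<Rightarrow> real" where
  "LP_block_norm \<Phi> k u = (SUP x. norm (LP_block \<Phi> k u x))"

definition besov_space :: "(real \<Rightarrow> real) \<Rightarrow> real \<Rightarrow> ((real \<Rightarrow> complex) \<Rightarrow> complex) set" where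
  "besov_space \<Phi> q =
     {u. periodic_distribution u \<and> summable (\<lambda>k. LP_block_norm \<Phi> k u powr q)}"

definition besov_norm :: "(real \<Rightarrow> real) \<Rightarrow> real \<Rightarrow> ((real \<Rightarrow> complex) \<Rightarrow> complex) \<Rightarrow> real" where
  "besov_norm \<Phi> q u = (\<Sum>k. LP_block_norm \<Phi> k u powr q) powr (1 / q)"

definition represents :: "(real \<Rightarrow> complex) \<Rightarrow> ((real \<Rightarrow> complex) \<Rightarrow> complex) \<Rightarrow> bool" where
  "represents f u \<longleftrightarrow>
     periodic1 f \<and> set_integrable lebesgue {0..<1} f \<and>
     (\<forall>\<psi>. test_function \<psi> \<longrightarrow> u \<psi> = (LINT x:{0..<1}|lebesgue. f x * \<psi> x))"

definition decr_rearrangement :: "(real \<Rightarrow> complex) \<Rightarrow> real \<Rightarrow> ennreal" where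
  "decr_rearrangement f t =
     (INF s \<in> {s::real. 0 \<le> s \<and> emeasure lebesgue {x \<in> {0..<1}. norm (f x) > s} \<le> ennreal t}.
        ennreal s)"

(* All functions representing u agree almost everywhere and have the same rearrangement, so the
   infimum runs over a single value.  It is \<infinity> if u is not a locally integrable function:
   no element of the unit ball is disregarded in the supremum below. *)
definition distr_rearrangement :: "((real \<Rightarrow> complex) \<Rightarrow> complex) \<Rightarrow> real \<Rightarrow> ennreal" where
  "distr_rearrangement u t = (INF f \<in> {f. represents f u}. decr_rearrangement f t)"

definition growth_envelope :: "(real \<Rightarrow> real) \<Rightarrow> real \<Rightarrow> real \<Rightarrow> ennreal" where
  "growth_envelope \<Phi> q t =
     (SUP u \<in> {u \<in> besov_space \<Phi> q. besov_norm \<Phi> q u \<le> 1}. distr_rearrangement u t)"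

end

theory Submission
  imports Defs
begin

text \<open>Write \<open>a\<^sub>k = \<parallel>L\<^sub>k f\<parallel>\<^sub>\<infinity>\<close>, so that \<open>\<Sum>a\<^sub>k\<^sup>q \<le> 1\<close>.

\<^bold>\<open>Upper bound.\<close>  The heart is the exponential estimate
\<open>\<integral> exp (Re \<Sum>L\<^sub>k f) \<le> exp (C + C \<Sum>a\<^sub>k\<^sup>q)\<close> for finite sums (\<open>exp_integral_blocks\<close>), which is a
concentration inequality of Azuma-Hoeffding type.  Averages over dyadic intervals turn the sum into
a martingale.  The block \<open>L\<^sub>k f\<close> contributes at most a constant times \<open>2 ^ (- \<bar>j - k\<bar>) a\<^sub>k\<close> to its
\<open>j\<close>-th increment: at fine scales \<open>j \<ge> k\<close> the block hardly varies, by Bernstein's inequality, and at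
coarse scales \<open>j < k\<close> it averages out, by the reverse Bernstein inequality for its antiderivative
(\<open>dyadic_block_dmean\<close>).  An increment bounded by \<open>d\<close> costs a factor \<open>cosh d\<close>, and
\<open>cosh d \<le> exp (d\<^sup>q)\<close> exactly because \<open>1 \<le> q \<le> 2\<close>; this is how the intermediate exponents are reached
without interpolation.  Young's inequality sums the increments in \<open>\<ell>\<^sup>q\<close>.  Applied to \<open>\<theta> f\<close>, the
estimate gives \<open>\<bar>{\<bar>f\<bar> > s}\<bar> \<le> C exp (C \<theta>\<^sup>q - c \<theta> s)\<close>, and \<open>\<theta> = \<bar>ln t\<bar> powr (1/q)\<close> together with \<open>s\<close> a large
multiple of \<open>\<bar>ln t\<bar> powr (1 - 1/q)\<close> makes the right side at most \<open>t\<close>.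

The same estimate shows that the partial sums are Cauchy in \<open>L\<^sup>1\<close>.  Their limit represents the
distribution because a distribution is determined by its Fourier coefficients: the Jackson means of
a test function are trigonometric sums that converge to it with all derivatives
(\<open>distribution_eq_integral\<close>).

\<^bold>\<open>Lower bound.\<close>  The sum \<open>K powr (- 1/q) \<Sum>k<K. ee (2 ^ k)\<close> has norm one, as each of its terms is seen
by exactly one block.  All terms have real part at least \<open>1/2\<close> on an interval of length
\<open>2 ^ (- K) / 3\<close>, so the sum has modulus at least \<open>K powr (1 - 1/q) / 2\<close> there; take \<open>K\<close> comparable to \<open>\<bar>ln t\<bar>\<close>.
Every function that represents the same distribution agrees with this sum almost everywhere
(\<open>fourier_uniqueness\<close>), so no other representative has a smaller rearrangement.\<close>

section \<open>Exponentials on the circle\<close>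

abbreviation torus :: "real measure" where
  "torus \<equiv> lebesgue_on {0..<1}"

definition ee :: "int \<Rightarrow> real \<Rightarrow> complex" where
  "ee n x = cis (2 * pi * of_int n * x)"

lemma exp_eq_ee:
  "exp (2 * of_real pi * \<i> * of_int n * of_real x) = ee n x"
  "exp (- 2 * of_real pi * \<i> * of_int n * of_real x) = ee (- n) x"
  by (simp_all add: ee_def cis_conv_exp mult_ac)

lemma norm_ee [simp]: "norm (ee n x) = 1"
  by (simp add: ee_def)

lemma ee_0 [simp]: "ee 0 x = 1" "ee n 0 = 1"
  by (simp_all add: ee_def)

lemma ee_mult: "ee m x * ee n x = ee (m + n) x"
  by (simp add: ee_def cis_mult algebra_simps)

lemma ee_diff: "ee n (x - y) = ee n x * ee (- n) y"
  by (simp add: ee_def cis_mult algebra_simps)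

lemma cnj_ee: "cnj (ee n x) = ee (- n) x"
  by (simp add: ee_def cis_cnj)

lemma ee_int: "ee n (of_int k) = 1"
proof -
  have "ee n (of_int k) = cis (2 * pi * of_int (n * k))" by (simp add: ee_def mult_ac)
  also have "\<dots> = 1" by (rule cis_multiple_2pi) simp
  finally show ?thesis .
qed

lemma ee_add_int: "ee n (x + of_int k) = ee n x"
  using ee_diff[of n x "- of_int k"] ee_int[of "-n" "-k"] by simp

lemma periodic1_ee: "periodic1 (ee n)"
  using ee_add_int[of n _ 1] by (simp add: periodic1_def)

lemma has_vector_derivative_ee [derivative_intros]:
  "(ee n has_vector_derivative 2 * of_real pi * \<i> * of_int n * ee n x) (at x within S)"
  unfolding ee_def cis_conv_exp
  by (auto intro!: derivative_eq_intros has_vector_derivative_real_field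
       simp: field_simps scaleR_conv_of_real)

lemma continuous_on_ee [continuous_intros]: "continuous_on S (ee n)"
  unfolding ee_def by (intro continuous_intros)

lemma continuous_on_ee' [continuous_intros]:
  "continuous_on S f \<Longrightarrow> continuous_on S (\<lambda>x. ee n (f x))"
  unfolding ee_def by (intro continuous_intros)

lemma norm_ee_minus_one: "(norm (1 - ee 1 x))\<^sup>2 = 4 * (sin (pi * x))\<^sup>2"
proof -
  have "(norm (1 - ee 1 x))\<^sup>2 = (1 - cos (2 * (pi * x)))\<^sup>2 + (sin (2 * (pi * x)))\<^sup>2"
    by (simp add: ee_def cmod_power2 mult_ac)
  also have "\<dots> = 2 - 2 * cos (2 * (pi * x))"
    using sin_cos_squared_add[of "2 * (pi * x)"] by (simp add: power2_eq_square algebra_simps)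
  also have "\<dots> = 4 * (sin (pi * x))\<^sup>2"
    by (simp add: cos_double_sin)
  finally show ?thesis .
qed

lemma integrable_torus_continuous:
  fixes f :: "real \<Rightarrow> 'a::euclidean_space"
  assumes "continuous_on {0..1} f"
  shows "integrable torus f" and "(LINT x|torus. f x) = integral {0..1} f"
proof -
  have "set_integrable lebesgue {0..1} f"
    using absolutely_integrable_continuous_real[OF assms] by simp
  then have "set_integrable lebesgue {0..<1} f"
    by (rule set_integrable_subset) auto
  then show I: "integrable torus f"
    by (simp add: integrable_restrict_space set_integrable_def)
  have "(LINT x|torus. f x) = integral {0..<1} f"
    by (rule lebesgue_integral_eq_integral[OF I]) simp
  also have "\<dots> = integral {0..1} f"
  proof (rule integral_subset_negligible)
    show "negligible ({0..1} - {0..<1::real})"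
      by (rule negligible_subset[of "{1}"]) auto
  qed auto
  finally show "(LINT x|torus. f x) = integral {0..1} f" .
qed

lemma set_integral_torus:
  fixes f :: "real \<Rightarrow> 'a::euclidean_space"
  shows "(LINT x:{0..<1}|lebesgue. f x) = (LINT x|torus. f x)"
    and "set_integrable lebesgue {0..<1} f = integrable torus f"
  by (simp_all add: integral_restrict_space integrable_restrict_space set_integrable_def
      set_lebesgue_integral_def)

lemma finite_measure_torus: "finite_measure torus"
  by (rule finite_measureI) (simp add: emeasure_restrict_space)

lemma integrable_torus_const [simp]: "integrable torus (\<lambda>_. c :: complex)"
  by (rule integrable_torus_continuous(1)) (intro continuous_intros)

lemma integrable_ee [simp]: "integrable torus (ee n)"
  by (rule integrable_torus_continuous(1)) (intro continuous_intros)

lemma integral_ee: "(LINT x|torus. ee n x) = (if n = 0 then 1 else 0)"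
proof -
  have 1: "(LINT x|torus. ee n x) = integral {0..1} (ee n)"
    by (rule integrable_torus_continuous(2)) (intro continuous_intros)
  show ?thesis
  proof (cases "n = 0")
    case True
    then have "ee n = (\<lambda>_. 1)" by auto
    then show ?thesis using True unfolding 1 by simp
  next
    case False
    have "((\<lambda>x. 2 * of_real pi * \<i> * of_int n * ee n x) has_integral (ee n 1 - ee n 0)) {0..1}"
      by (rule fundamental_theorem_of_calculus) (auto intro: has_vector_derivative_ee)
    then have "((\<lambda>x. (1 / (2 * of_real pi * \<i> * of_int n)) * (2 * of_real pi * \<i> * of_int n * ee n x))
        has_integral (1 / (2 * of_real pi * \<i> * of_int n)) * (ee n 1 - ee n 0)) {0..1}"
      by (rule has_integral_mult_right)
    moreover have "(\<lambda>x. (1 / (2 * of_real pi * \<i> * of_int n)) * (2 * of_real pi * \<i> * of_int n * ee n x)) = ee n"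
      using False by auto
    moreover have "ee n 1 = 1" using ee_int[of n 1] by simp
    ultimately have "(ee n has_integral 0) {0..1}" by simp
    then show ?thesis using False unfolding 1 by (simp add: integral_unique)
  qed
qed

section \<open>Convolution with a trigonometric kernel\<close>

definition tcoeff :: "(real \<Rightarrow> complex) \<Rightarrow> int \<Rightarrow> complex" where
  "tcoeff f n = (LINT x|torus. f x * ee (- n) x)"

lemma integrable_mult_ee:
  assumes "integrable torus f"
  shows "integrable torus (\<lambda>x. f x * ee n x)"
proof (rule Bochner_Integration.integrable_bound[OF assms])
  have "ee n \<in> borel_measurable torus" by (rule borel_measurable_integrable) simp
  then show "(\<lambda>x. f x * ee n x) \<in> borel_measurable torus"
    using assms by (intro borel_measurable_times) auto
qed (simp add: norm_mult)

text \<open>A kernel is indexed by an arbitrary finite set, so that the product of two trigonometric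
  sums is again of this form without collecting equal frequencies.\<close>

lemma integrable_kernel:
  assumes "integrable torus f"
  shows "integrable torus (\<lambda>s. (\<Sum>i\<in>I. w i * ee (d i) (x - s)) * f s)"
proof -
  have "integrable torus (\<lambda>s. \<Sum>i\<in>I. (w i * ee (d i) x) * (f s * ee (- d i) s))"
    by (intro Bochner_Integration.integrable_sum integrable_mult_right integrable_mult_ee assms)
  then show ?thesis by (simp add: ee_diff sum_distrib_left sum_distrib_right mult_ac)
qed

lemma integral_kernel:
  assumes "integrable torus f"
  shows "(LINT s|torus. (\<Sum>i\<in>I. w i * ee (d i) (x - s)) * f s) =
    (\<Sum>i\<in>I. w i * tcoeff f (d i) * ee (d i) x)"
proof -
  have "(LINT s|torus. (\<Sum>i\<in>I. w i * ee (d i) (x - s)) * f s) =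
      (LINT s|torus. (\<Sum>i\<in>I. (w i * ee (d i) x) * (f s * ee (- d i) s)))"
    by (simp add: ee_diff sum_distrib_left sum_distrib_right mult_ac)
  also have "\<dots> = (\<Sum>i\<in>I. (w i * ee (d i) x) * (LINT s|torus. f s * ee (- d i) s))"
    by (subst Bochner_Integration.integral_sum)
      (auto intro!: integrable_mult_right integrable_mult_ee assms)
  finally show ?thesis by (simp add: tcoeff_def mult_ac)
qed

lemma tcoeff_const: "tcoeff (\<lambda>_. c) n = (if n = 0 then c else 0)"
  by (simp add: tcoeff_def integral_ee)

lemma tcoeff_sum:
  assumes "finite I"
  shows "tcoeff (\<lambda>x. \<Sum>i\<in>I. c i * ee (d i) x) n = (\<Sum>i\<in>I. c i * (if d i = n then 1 else 0))"
proof -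
  have "tcoeff (\<lambda>x. \<Sum>i\<in>I. c i * ee (d i) x) n = (LINT x|torus. (\<Sum>i\<in>I. c i * ee (d i - n) x))"
    by (simp add: tcoeff_def sum_distrib_right mult.assoc ee_mult)
  also have "\<dots> = (\<Sum>i\<in>I. c i * (LINT x|torus. ee (d i - n) x))"
    by (subst Bochner_Integration.integral_sum) auto
  finally show ?thesis by (simp add: integral_ee)
qed

lemma continuous_on_tsum [continuous_intros]:
  "continuous_on S (\<lambda>x. \<Sum>i\<in>I. c i * ee (d i) x)"
  by (intro continuous_intros)

lemma integrable_tsum [simp]: "integrable torus (\<lambda>x. \<Sum>i\<in>I. c i * ee (d i) x)"
  by (intro Bochner_Integration.integrable_sum integrable_mult_right integrable_ee)

lemma has_vector_derivative_tsum:
  "((\<lambda>x. \<Sum>i\<in>I. c i * ee (d i) x) has_vector_derivative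
     (\<Sum>i\<in>I. c i * (2 * of_real pi * \<i> * of_int (d i)) * ee (d i) x)) (at x within S)"
  by (auto intro!: derivative_eq_intros has_vector_derivative_sum simp: mult_ac)

lemma periodic1_tsum: "periodic1 (\<lambda>x. \<Sum>i\<in>I. c i * ee (d i) x)"
  using periodic1_ee by (simp add: periodic1_def)

text \<open>Parseval's identity, in the form in which the squared modulus of a trigonometric sum is
  itself used as a convolution kernel.\<close>

lemma norm_square_tsum:
  "of_real ((norm (\<Sum>a\<in>A. of_real (\<alpha> a) * ee (int a) x))\<^sup>2) =
   (\<Sum>p\<in>A \<times> A. of_real (\<alpha> (fst p) * \<alpha> (snd p)) * ee (int (fst p) - int (snd p)) x)"
proof -
  have "of_real ((norm (\<Sum>a\<in>A. of_real (\<alpha> a) * ee (int a) x))\<^sup>2) =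
      (\<Sum>a\<in>A. of_real (\<alpha> a) * ee (int a) x) * (\<Sum>b\<in>A. of_real (\<alpha> b) * ee (- int b) x)"
    by (simp add: complex_norm_square cnj_ee del: of_real_power)
  also have "\<dots> = (\<Sum>a\<in>A. \<Sum>b\<in>A. of_real (\<alpha> a * \<alpha> b) * (ee (int a) x * ee (- int b) x))"
    unfolding sum_product by (simp add: mult_ac)
  also have "\<dots> = (\<Sum>a\<in>A. \<Sum>b\<in>A. of_real (\<alpha> a * \<alpha> b) * ee (int a - int b) x)"
    by (simp add: ee_mult)
  finally show ?thesis by (simp add: sum.cartesian_product case_prod_beta)
qed

lemma parseval:
  assumes "finite A"
  shows "(LINT s|torus. (norm (\<Sum>a\<in>A. of_real (\<alpha> a) * ee (int a) (x - s)))\<^sup>2) = (\<Sum>a\<in>A. (\<alpha> a)\<^sup>2)"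
proof -
  have "of_real (LINT s|torus. (norm (\<Sum>a\<in>A. of_real (\<alpha> a) * ee (int a) (x - s)))\<^sup>2) =
      (LINT s|torus. complex_of_real ((norm (\<Sum>a\<in>A. of_real (\<alpha> a) * ee (int a) (x - s)))\<^sup>2) * 1)"
    by (simp add: integral_complex_of_real del: of_real_power)
  also have "\<dots> = (\<Sum>p\<in>A \<times> A. of_real (\<alpha> (fst p) * \<alpha> (snd p)) *
      (if int (fst p) - int (snd p) = 0 then 1 else 0) * ee (int (fst p) - int (snd p)) x)"
    unfolding norm_square_tsum by (subst integral_kernel) (simp_all add: tcoeff_const)
  also have "\<dots> = (\<Sum>a\<in>A. \<Sum>b\<in>A. if a = b then of_real (\<alpha> a * \<alpha> b) else 0)"
    unfolding sum.cartesian_product by (intro sum.cong) auto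
  also have "\<dots> = of_real (\<Sum>a\<in>A. (\<alpha> a)\<^sup>2)"
    using assms by (simp add: sum.delta power2_eq_square)
  finally show ?thesis using of_real_eq_iff by blast
qed

section \<open>The Jackson kernel\<close>

text \<open>The weights form a parabola that vanishes at \<open>0\<close> and \<open>N + 1\<close>.  Their differences are then
  small compared with the weights themselves, which gives the kernel a second moment of order
  \<open>1 / N\<^sup>2\<close>; constant weights would produce the Fejer kernel, whose second moment is only of order
  \<open>1 / N\<close>.\<close>

definition jweight :: "nat \<Rightarrow> nat \<Rightarrow> real" where
  "jweight N a = real a * (real N + 1 - real a)"

definition jmass :: "nat \<Rightarrow> real" where
  "jmass N = (\<Sum>a\<in>{1..N}. (jweight N a)\<^sup>2)"

definition jackson :: "nat \<Rightarrow> real \<Rightarrow> real" where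
  "jackson N x = (norm (\<Sum>a\<in>{1..N}. of_real (jweight N a) * ee (int a) x))\<^sup>2 / jmass N"

lemma sum_parabola_squares:
  "(\<Sum>a\<in>{1..M}. (real a * (c - real a))\<^sup>2) =
    c\<^sup>2 * (real M * (real M + 1) * (2 * real M + 1) / 6) - c * (real M * (real M + 1))\<^sup>2 / 2 +
    real M * (real M + 1) * (2 * real M + 1) * (3 * (real M)\<^sup>2 + 3 * real M - 1) / 30"
  by (induction M) (simp_all add: field_simps power2_eq_square)

lemma sum_affine_squares:
  "(\<Sum>a\<in>{1..M}. (c - 2 * real a)\<^sup>2) =
    c\<^sup>2 * real M - 2 * c * real M * (real M + 1) + 2 * real M * (real M + 1) * (2 * real M + 1) / 3"
  by (induction M) (simp_all add: field_simps power2_eq_square)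

lemma jmass_eq: "jmass N = (real N + 1) * ((real N + 1) ^ 4 - 1) / 30"
  unfolding jmass_def jweight_def sum_parabola_squares
  by (simp add: field_simps power2_eq_square power4_eq_xxxx)

lemma jmass_pos: "N \<ge> 1 \<Longrightarrow> jmass N > 0"
  unfolding jmass_eq by (simp add: one_less_power)

lemma jackson_nonneg: "N \<ge> 1 \<Longrightarrow> jackson N x \<ge> 0"
  using jmass_pos[of N] by (simp add: jackson_def)

lemma continuous_on_jackson [continuous_intros]:
  "continuous_on S f \<Longrightarrow> continuous_on S (\<lambda>s. jackson N (f s))"
proof (cases "N = 0")
  case False
  assume "continuous_on S f"
  then show ?thesis
    using jmass_pos[of N] False unfolding jackson_def by (intro continuous_intros) auto
qed (simp add: jackson_def jmass_def)

lemma integral_jackson: "N \<ge> 1 \<Longrightarrow> (LINT s|torus. jackson N (x - s)) = 1"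
  using jmass_pos[of N] unfolding jackson_def
  by (simp add: parseval jmass_def)

text \<open>Multiplying by \<open>1 - ee 1\<close> replaces the weights by their differences, so that the second
  moment of the kernel is again given by Parseval's identity.\<close>

lemma jackson_sin:
  assumes "N \<ge> 1"
  shows "jackson N x * (sin (pi * x))\<^sup>2 =
    (norm (\<Sum>a\<in>{1..N+1}. of_real (real N + 2 - 2 * real a) * ee (int a) x))\<^sup>2 / (4 * jmass N)"
proof -
  define Q where "Q = (\<Sum>a\<in>{1..N}. of_real (jweight N a) * ee (int a) x)"
  have "(1 - ee 1 x) * Q = (\<Sum>a\<in>{1..N}. of_real (jweight N a) * ee (int a) x)
      - (\<Sum>a\<in>{1..N}. of_real (jweight N a) * ee (int (Suc a)) x)"
    unfolding Q_def left_diff_distrib sum_distrib_left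
    by (simp add: mult.left_commute[of "ee 1 x"] ee_mult sum_subtractf)
  also have "(\<Sum>a\<in>{1..N}. of_real (jweight N a) * ee (int a) x) =
      (\<Sum>a\<in>{1..N+1}. of_real (jweight N a) * ee (int a) x)"
    by (simp add: jweight_def)
  also have "(\<Sum>a\<in>{1..N}. of_real (jweight N a) * ee (int (Suc a)) x) =
      (\<Sum>a\<in>{0..N}. of_real (jweight N a) * ee (int (Suc a)) x)"
    by (simp add: jweight_def sum.atLeast_Suc_atMost[of 0])
  also have "\<dots> = (\<Sum>a\<in>{1..N+1}. of_real (jweight N (a - 1)) * ee (int a) x)"
    using sum.shift_bounds_cl_Suc_ivl[of "\<lambda>a. of_real (jweight N (a - 1)) * ee (int a) x" 0 N]
    by simp
  also have "(\<Sum>a\<in>{1..N+1}. of_real (jweight N a) * ee (int a) x) - \<dots> =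
      (\<Sum>a\<in>{1..N+1}. of_real (real N + 2 - 2 * real a) * ee (int a) x)"
    unfolding sum_subtractf[symmetric]
  proof (intro sum.cong refl)
    fix a assume "a \<in> {1..N+1}"
    then have "jweight N a - jweight N (a - 1) = real N + 2 - 2 * real a"
      by (simp add: jweight_def of_nat_diff algebra_simps)
    then show "of_real (jweight N a) * ee (int a) x - of_real (jweight N (a - 1)) * ee (int a) x =
        of_real (real N + 2 - 2 * real a) * ee (int a) x"
      by (metis left_diff_distrib of_real_diff)
  qed
  finally have *: "(1 - ee 1 x) * Q =
      (\<Sum>a\<in>{1..N+1}. of_real (real N + 2 - 2 * real a) * ee (int a) x)" .
  have "jackson N x = (norm Q)\<^sup>2 / jmass N"
    by (simp only: jackson_def Q_def)
  then have "jackson N x * (sin (pi * x))\<^sup>2 = (norm ((1 - ee 1 x) * Q))\<^sup>2 / (4 * jmass N)"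
    by (simp add: norm_mult power_mult_distrib norm_ee_minus_one)
  then show ?thesis unfolding * .
qed

text \<open>With \<open>m = N + 1\<close>, the squares of the differences sum to \<open>m (m\<^sup>2 - 1) / 3\<close> and those of the
  weights to \<open>m (m\<^sup>4 - 1) / 30\<close>.\<close>

lemma integral_jackson_sin_square:
  assumes "N \<ge> 1"
  shows "(LINT s|torus. jackson N (x - s) * (sin (pi * (x - s)))\<^sup>2) \<le> 5 / (2 * (real N)\<^sup>2)"
proof -
  define m where "m = real N + 1"
  have m: "m > 1" using assms by (simp add: m_def)
  have "(LINT s|torus. jackson N (x - s) * (sin (pi * (x - s)))\<^sup>2) =
      (\<Sum>a\<in>{1..N+1}. (real N + 2 - 2 * real a)\<^sup>2) / (4 * jmass N)"
    unfolding jackson_sin[OF assms] by (simp only: integral_divide_zero parseval[OF finite_atLeastAtMost])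
  also have "(\<Sum>a\<in>{1..N+1}. (real N + 2 - 2 * real a)\<^sup>2) = m * (m\<^sup>2 - 1) / 3"
    unfolding sum_affine_squares by (simp add: m_def field_simps power2_eq_square)
  also have "jmass N = m * (m\<^sup>2 - 1) * (m\<^sup>2 + 1) / 30"
    unfolding jmass_eq by (simp add: m_def field_simps power2_eq_square power4_eq_xxxx)
  also have "m * (m\<^sup>2 - 1) / 3 / (4 * (m * (m\<^sup>2 - 1) * (m\<^sup>2 + 1) / 30)) = 5 / (2 * (m\<^sup>2 + 1))"
  proof -
    have nz: "m * (m\<^sup>2 - 1) \<noteq> 0" "m\<^sup>2 + 1 > 0" using m by (auto simp: power2_eq_1_iff add_pos_pos)
    have "A / 3 / (4 * (A * B / 30)) = 5 / (2 * B)" if "A \<noteq> 0" "B > 0" for A B :: real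
      using that by (simp add: divide_simps)
    from this[OF nz] show ?thesis .
  qed
  also have "\<dots> \<le> 5 / (2 * (real N)\<^sup>2)"
    using assms by (intro divide_left_mono) (auto simp: m_def power2_eq_square algebra_simps intro!: add_pos_pos mult_pos_pos)
  finally show ?thesis .
qed

text \<open>The first absolute moment, by the arithmetic-geometric mean inequality
  \<open>2\<bar>sin\<bar> \<le> N sin\<^sup>2 + 1/N\<close>.\<close>

lemma integral_jackson_sin:
  assumes "N \<ge> 1"
  shows "(LINT s|torus. jackson N (x - s) * \<bar>sin (pi * (x - s))\<bar>) \<le> 2 / real N"
proof -
  let ?J = "\<lambda>s. jackson N (x - s)" and ?S = "\<lambda>s. sin (pi * (x - s))"
  have N: "real N > 0" using assms by simp
  have i1: "integrable torus (\<lambda>s. ?J s * \<bar>?S s\<bar>)" "integrable torus ?J"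
    "integrable torus (\<lambda>s. ?J s * (?S s)\<^sup>2)"
    by (intro integrable_torus_continuous continuous_intros)+
  have "(LINT s|torus. ?J s * \<bar>?S s\<bar>) \<le>
      (LINT s|torus. real N / 2 * (?J s * (?S s)\<^sup>2) + 1 / (2 * real N) * ?J s)"
  proof (rule integral_mono)
    show "integrable torus (\<lambda>s. real N / 2 * (?J s * (?S s)\<^sup>2) + 1 / (2 * real N) * ?J s)"
      by (intro Bochner_Integration.integrable_add integrable_mult_right i1)
    fix s
    have "0 \<le> (real N * \<bar>?S s\<bar> - 1)\<^sup>2 / (2 * real N)" using N by simp
    also have "\<dots> = real N / 2 * (?S s)\<^sup>2 + 1 / (2 * real N) - \<bar>?S s\<bar>"
      using N by (simp add: power2_eq_square field_simps)
    finally have "\<bar>?S s\<bar> \<le> real N / 2 * (?S s)\<^sup>2 + 1 / (2 * real N)" by simp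
    from mult_left_mono[OF this jackson_nonneg[OF assms, of "x - s"]]
    show "?J s * \<bar>?S s\<bar> \<le> real N / 2 * (?J s * (?S s)\<^sup>2) + 1 / (2 * real N) * ?J s"
      by (simp add: algebra_simps)
  qed (rule i1)
  also have "\<dots> = real N / 2 * (LINT s|torus. ?J s * (?S s)\<^sup>2) + 1 / (2 * real N)"
    using i1 integral_jackson[OF assms, of x] by simp
  also have "\<dots> \<le> real N / 2 * (5 / (2 * (real N)\<^sup>2)) + 1 / (2 * real N)"
    using integral_jackson_sin_square[OF assms, of x] N by (intro add_right_mono mult_left_mono) auto
  also have "\<dots> \<le> 2 / real N"
    using N by (simp add: field_simps power2_eq_square)
  finally show ?thesis .
qed

section \<open>Approximation by Jackson means\<close>

text \<open>Concavity of the sine on a quarter period: the graph lies above its chord.\<close>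

lemma two_abs_le_abs_sin_pi:
  assumes "\<bar>y\<bar> \<le> 1 / 2"
  shows "2 * \<bar>y\<bar> \<le> \<bar>sin (pi * y)\<bar>"
proof -
  have *: "2 * y \<le> sin (pi * y)" if "0 \<le> y" "y \<le> 1 / 2" for y :: real
  proof -
    have "concave_on {0..1/2} (\<lambda>y. sin (pi * y))"
    proof (rule f''_le0_imp_concave)
      show "((\<lambda>y. sin (pi * y)) has_real_derivative pi * cos (pi * y)) (at y)" for y
        by (auto intro!: derivative_eq_intros)
      show "((\<lambda>y. pi * cos (pi * y)) has_real_derivative - (pi\<^sup>2 * sin (pi * y))) (at y)" for y
        by (auto intro!: derivative_eq_intros simp: power2_eq_square)
      show "- (pi\<^sup>2 * sin (pi * y)) \<le> 0" if "y \<in> {0..1/2}" for y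
      proof -
        have "pi * y \<le> pi * 1" using that by (intro mult_left_mono) auto
        then have "0 \<le> sin (pi * y)" using that by (intro sin_ge_zero) auto
        then show ?thesis by simp
      qed
    qed auto
    then have "(1 - 2 * y) * sin (pi * 0) + (2 * y) * sin (pi * (1/2)) \<le>
        sin (pi * ((1 - 2 * y) *\<^sub>R 0 + (2 * y) *\<^sub>R (1 / 2)))"
      using concave_onD[of "{0..1/2::real}" "\<lambda>y. sin (pi * y)" "2 * y" 0 "1/2"] that by auto
    then show ?thesis by simp
  qed
  show ?thesis
  proof (cases "y \<ge> 0")
    case True
    then show ?thesis using *[of y] assms by linarith
  next
    case False
    then show ?thesis using *[of "- y"] assms by (auto simp: abs_if)
  qed
qed

lemma periodic1_add_int:
  assumes "periodic1 f"
  shows "f (x + of_int k) = f x"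
proof -
  have nat: "f (x + real n) = f x" for n x
  proof (induction n)
    case (Suc n)
    have "f (x + real (Suc n)) = f ((x + real n) + 1)" by (simp add: algebra_simps)
    then show ?case using assms Suc by (simp add: periodic1_def)
  qed simp
  show ?thesis
  proof (cases "k \<ge> 0")
    case True
    then show ?thesis using nat[of x "nat k"] by simp
  next
    case False
    then show ?thesis using nat[of "x + of_int k" "nat (- k)"] by simp
  qed
qed

text \<open>The sine measures the distance on the circle, and it is the quantity whose moments under the
  Jackson kernel are known.  By periodicity \<open>s\<close> may be moved by an integer so that it lies within
  \<open>1 / 2\<close> of \<open>x\<close>.\<close>

lemma periodic_increment_le_sin:
  fixes f f' :: "real \<Rightarrow> complex"
  assumes per: "periodic1 f"
    and der: "\<And>x. (f has_vector_derivative f' x) (at x)" and bnd: "\<And>x. norm (f' x) \<le> M"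
  shows "norm (f s - f x) \<le> M / 2 * \<bar>sin (pi * (x - s))\<bar>"
proof -
  define k where "k = round (x - s)"
  define y where "y = x - s - of_int k"
  have y: "\<bar>y\<bar> \<le> 1 / 2"
    using of_int_round_abs_le[of "x - s"] by (simp add: y_def k_def abs_minus_commute)
  have M: "M \<ge> 0" using bnd[of 0] norm_ge_zero order_trans by blast
  have "norm (f s - f x) = norm (f (x - y) - f x)"
    using periodic1_add_int[OF per, of s k] by (simp add: y_def algebra_simps)
  also have "\<dots> \<le> M * norm ((x - y) - x)"
  proof (rule differentiable_bound[of UNIV])
    show "(f has_derivative (\<lambda>h. h *\<^sub>R f' z)) (at z within UNIV)" for z
      using der[of z] by (simp add: has_vector_derivative_def)
    show "onorm (\<lambda>h. h *\<^sub>R f' z) \<le> M" for z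
      using bnd[of z] by (intro onorm_le) (simp add: mult.commute[of M] mult_left_mono)
  qed auto
  also have "\<dots> = M / 2 * (2 * \<bar>y\<bar>)" by simp
  also have "\<dots> \<le> M / 2 * \<bar>sin (pi * y)\<bar>"
    using two_abs_le_abs_sin_pi[OF y] M by (intro mult_left_mono) auto
  also have "\<bar>sin (pi * y)\<bar> = \<bar>sin (pi * (x - s))\<bar>"
  proof -
    have "pi * y = pi * (x - s) - of_int k * pi" by (simp add: y_def algebra_simps)
    then show ?thesis by (simp add: sin_diff abs_mult sin_npi_int cos_npi_int abs_if mult.commute)
  qed
  finally show ?thesis .
qed

text \<open>Convolution with the Jackson kernel, written out as a trigonometric sum, so that its derivatives
  and its pairing with a distribution can be computed term by term.\<close>

definition jackson_mean :: "nat \<Rightarrow> (real \<Rightarrow> complex) \<Rightarrow> real \<Rightarrow> complex" where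
  "jackson_mean N f x = (\<Sum>p\<in>{1..N}\<times>{1..N}.
     of_real (jweight N (fst p) * jweight N (snd p) / jmass N) *
       tcoeff f (int (fst p) - int (snd p)) * ee (int (fst p) - int (snd p)) x)"

lemma jackson_mean_tsum:
  "jackson_mean N f = (\<lambda>x. \<Sum>p\<in>{1..N}\<times>{1..N}. (of_real (jweight N (fst p) * jweight N (snd p) / jmass N) *
       tcoeff f (int (fst p) - int (snd p))) * ee (int (fst p) - int (snd p)) x)"
  by (rule ext) (rule jackson_mean_def)

lemma integral_mult_jackson_mean:
  assumes "integrable torus f"
  shows "(LINT x|torus. f x * jackson_mean N g x) = (\<Sum>p\<in>{1..N}\<times>{1..N}.
     (of_real (jweight N (fst p) * jweight N (snd p) / jmass N) * tcoeff g (int (fst p) - int (snd p))) *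
       (LINT x|torus. f x * ee (int (fst p) - int (snd p)) x))"
  unfolding jackson_mean_tsum sum_distrib_left mult.left_commute[of "f _"]
  by (subst Bochner_Integration.integral_sum)
    (auto intro!: integrable_mult_right integrable_mult_ee assms)

lemma of_real_jackson:
  "complex_of_real (jackson N x) = (\<Sum>p\<in>{1..N}\<times>{1..N}.
     of_real (jweight N (fst p) * jweight N (snd p) / jmass N) * ee (int (fst p) - int (snd p)) x)"
  unfolding jackson_def of_real_divide norm_square_tsum
  by (simp add: sum_divide_distrib)

lemma jackson_mean_eq_integral:
  assumes "integrable torus f"
  shows "integrable torus (\<lambda>s. of_real (jackson N (x - s)) * f s)"
    and "jackson_mean N f x = (LINT s|torus. of_real (jackson N (x - s)) * f s)"
  unfolding of_real_jackson jackson_mean_def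
  by (rule integrable_kernel[OF assms], rule integral_kernel[OF assms, symmetric])

lemma jackson_mean_minus:
  assumes "N \<ge> 1" "integrable torus f"
  shows "jackson_mean N f x - f x = (LINT s|torus. of_real (jackson N (x - s)) * (f s - f x))"
    and "integrable torus (\<lambda>s. of_real (jackson N (x - s)) * (f s - f x))"
proof -
  have c: "(LINT s|torus. complex_of_real (jackson N (x - s))) = 1"
    by (simp only: integral_complex_of_real integral_jackson[OF assms(1)] of_real_1)
  have i: "integrable torus (\<lambda>s. complex_of_real (jackson N (x - s)))"
    by (intro integrable_torus_continuous continuous_intros)
  have i': "integrable torus (\<lambda>s. complex_of_real (jackson N (x - s)) * f x)"
    using i by (rule integrable_mult_left)
  show "integrable torus (\<lambda>s. of_real (jackson N (x - s)) * (f s - f x))"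
    unfolding right_diff_distrib
    by (intro Bochner_Integration.integrable_diff jackson_mean_eq_integral i' assms)
  show "jackson_mean N f x - f x = (LINT s|torus. of_real (jackson N (x - s)) * (f s - f x))"
    unfolding right_diff_distrib jackson_mean_eq_integral(2)[OF assms(2)]
    by (subst Bochner_Integration.integral_diff[OF jackson_mean_eq_integral(1)[OF assms(2)] i'])
      (simp only: integral_mult_left_zero c mult_1)
qed

text \<open>The majorant \<open>h\<close> of the increments of \<open>f\<close> is left open: a multiple of \<open>\<bar>sin\<bar>\<close> serves for smooth
  functions, a multiple of \<open>sin\<^sup>2\<close> for the indicator of an interval.\<close>

lemma norm_jackson_mean_minus:
  assumes N: "N \<ge> 1" and f: "integrable torus f"
    and h: "integrable torus (\<lambda>s. jackson N (x - s) * h s)"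
    and le: "\<And>s. s \<in> {0..<1} \<Longrightarrow> norm (f s - f x) \<le> h s"
  shows "norm (jackson_mean N f x - f x) \<le> (LINT s|torus. jackson N (x - s) * h s)"
proof -
  have "norm (jackson_mean N f x - f x) \<le>
      (LINT s|torus. norm (of_real (jackson N (x - s)) * (f s - f x)))"
    unfolding jackson_mean_minus(1)[OF N f] by (rule integral_norm_bound)
  also have "\<dots> \<le> (LINT s|torus. jackson N (x - s) * h s)"
  proof (rule integral_mono)
    show "integrable torus (\<lambda>s. norm (of_real (jackson N (x - s)) * (f s - f x)))"
      by (rule integrable_norm[OF jackson_mean_minus(2)[OF N f]])
    fix s assume "s \<in> space torus"
    then show "norm (of_real (jackson N (x - s)) * (f s - f x)) \<le> jackson N (x - s) * h s"
      using le[of s] jackson_nonneg[OF N, of "x - s"] by (simp add: norm_mult mult_left_mono)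
  qed (rule h)
  finally show ?thesis .
qed

lemma jackson_mean_approx:
  fixes f f' :: "real \<Rightarrow> complex"
  assumes N: "N \<ge> 1" and per: "periodic1 f"
    and der: "\<And>x. (f has_vector_derivative f' x) (at x)" and bnd: "\<And>x. norm (f' x) \<le> M"
  shows "norm (jackson_mean N f x - f x) \<le> M / real N"
proof -
  have M: "M \<ge> 0" using bnd[of 0] norm_ge_zero order_trans by blast
  have "continuous_on {0..1} f"
    using der has_vector_derivative_continuous by (blast intro: continuous_at_imp_continuous_on)
  then have f: "integrable torus f" by (rule integrable_torus_continuous)
  have "norm (jackson_mean N f x - f x) \<le>
      (LINT s|torus. jackson N (x - s) * (M / 2 * \<bar>sin (pi * (x - s))\<bar>))"
    by (rule norm_jackson_mean_minus[OF N f]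
        integrable_torus_continuous continuous_intros periodic_increment_le_sin[OF per der bnd])+
  also have "\<dots> = M / 2 * (LINT s|torus. jackson N (x - s) * \<bar>sin (pi * (x - s))\<bar>)"
    by (simp add: mult.left_commute)
  also have "\<dots> \<le> M / 2 * (2 / real N)"
    using integral_jackson_sin[OF N] M by (intro mult_left_mono) auto
  finally show ?thesis by simp
qed

section \<open>Bernstein inequalities\<close>

text \<open>The Jackson kernel of order \<open>N\<close> has frequencies below \<open>N\<close>, so it annihilates a sum with
  all frequencies at least \<open>N\<close>, and the approximation estimate bounds the sum itself.\<close>

lemma reverse_bernstein:
  assumes "finite I" and N: "N \<ge> 1" and freq: "\<And>i. i \<in> I \<Longrightarrow> int N \<le> \<bar>d i\<bar>"
    and bnd: "\<And>x. norm (\<Sum>i\<in>I. c i * (2 * of_real pi * \<i> * of_int (d i)) * ee (d i) x) \<le> M"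
  shows "norm (\<Sum>i\<in>I. c i * ee (d i) x) \<le> M / real N"
proof -
  let ?F = "\<lambda>x. \<Sum>i\<in>I. c i * ee (d i) x"
  have "tcoeff ?F n = 0" if "\<bar>n\<bar> < int N" for n
    unfolding tcoeff_sum[OF assms(1)] using freq that by (intro sum.neutral) force
  then have "jackson_mean N ?F x = 0"
    unfolding jackson_mean_def by (intro sum.neutral) auto
  then show ?thesis
    using jackson_mean_approx[OF N periodic1_tsum has_vector_derivative_tsum bnd, of x] by simp
qed

lemma card_differences:
  "card {p \<in> {..<N} \<times> {..<N}. int (fst p) - int (snd p) = d} = nat (int N - \<bar>d\<bar>)"
proof (cases "d \<ge> 0")
  case True
  have "{p \<in> {..<N} \<times> {..<N}. int (fst p) - int (snd p) = d} = (\<lambda>b. (b + nat d, b)) ` {..<N - nat d}"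
    using True by (auto simp: image_iff)
  also have "card \<dots> = N - nat d" by (subst card_image) (auto simp: inj_on_def)
  finally show ?thesis using True by auto
next
  case False
  have "{p \<in> {..<N} \<times> {..<N}. int (fst p) - int (snd p) = d} = (\<lambda>b. (b, b + nat (- d))) ` {..<N - nat (- d)}"
    using False by (auto simp: image_iff)
  also have "card \<dots> = N - nat (- d)" by (subst card_image) (auto simp: inj_on_def)
  finally show ?thesis using False by auto
qed

lemma fejer_shift_coefficient:
  assumes "finite I"
  shows "(LINT s|torus. (\<Sum>p\<in>{..<N}\<times>{..<N}. ee (k + (int (fst p) - int (snd p))) (x - s)) *
       (\<Sum>i\<in>I. c i * ee (d i) s)) =
    (\<Sum>i\<in>I. of_nat (nat (int N - \<bar>d i - k\<bar>)) * c i * ee (d i) x)"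
proof -
  have "(LINT s|torus. (\<Sum>p\<in>{..<N}\<times>{..<N}. ee (k + (int (fst p) - int (snd p))) (x - s)) *
       (\<Sum>i\<in>I. c i * ee (d i) s)) =
     (\<Sum>p\<in>{..<N}\<times>{..<N}. \<Sum>i\<in>I.
       if int (fst p) - int (snd p) = d i - k then c i * ee (d i) x else 0)"
    using integral_kernel[where f = "\<lambda>x. \<Sum>i\<in>I. c i * ee (d i) x" and I = "{..<N}\<times>{..<N}"
        and w = "\<lambda>_. 1" and d = "\<lambda>p. k + (int (fst p) - int (snd p))" and x = x]
    by (auto simp: tcoeff_sum[OF assms] sum_distrib_right intro!: sum.cong)
  also have "\<dots> = (\<Sum>i\<in>I. \<Sum>p\<in>{..<N}\<times>{..<N}.
       if int (fst p) - int (snd p) = d i - k then c i * ee (d i) x else 0)"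
    by (rule sum.swap)
  also have "\<dots> = (\<Sum>i\<in>I. of_nat (nat (int N - \<bar>d i - k\<bar>)) * (c i * ee (d i) x))"
    by (intro sum.cong refl) (simp add: sum.inter_filter[symmetric] card_differences)
  finally show ?thesis by (simp add: mult.assoc)
qed

text \<open>Differentiation of a sum of degree at most \<open>N\<close> is convolution with
  \<open>2 \<pi> \<i> (ee N - ee (- N))\<close> times the unnormalised Fejer kernel, as the triangular coefficients of the two
  shifted Fejer kernels differ by \<open>n\<close> at every frequency \<open>n\<close> in \<open>[- N, N]\<close>.\<close>

lemma bernstein:
  assumes "finite I" and N: "N \<ge> 1" and freq: "\<And>i. i \<in> I \<Longrightarrow> \<bar>d i\<bar> \<le> int N"
    and bnd: "\<And>x. norm (\<Sum>i\<in>I. c i * ee (d i) x) \<le> M"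
  shows "norm (\<Sum>i\<in>I. c i * (2 * of_real pi * \<i> * of_int (d i)) * ee (d i) x) \<le> 4 * pi * real N * M"
proof -
  let ?P = "\<lambda>s. \<Sum>i\<in>I. c i * ee (d i) s"
  let ?D = "\<lambda>y. (norm (\<Sum>a<N. of_real 1 * ee (int a) y))\<^sup>2"
  let ?K = "\<lambda>k y. \<Sum>p\<in>{..<N}\<times>{..<N}. ee (k + (int (fst p) - int (snd p))) y"
  have K: "?K k y = ee k y * of_real (?D y)" for k y
    unfolding norm_square_tsum by (simp add: sum_distrib_left ee_mult)
  have int: "integrable torus (\<lambda>s. ?K k (x - s) * ?P s)" for k
    using integrable_kernel[of ?P "\<lambda>_. 1"] by simp
  have "(\<Sum>i\<in>I. c i * (2 * of_real pi * \<i> * of_int (d i)) * ee (d i) x) =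
      2 * of_real pi * \<i> * ((\<Sum>i\<in>I. of_nat (nat (int N - \<bar>d i - int N\<bar>)) * c i * ee (d i) x) -
        (\<Sum>i\<in>I. of_nat (nat (int N - \<bar>d i - (- int N)\<bar>)) * c i * ee (d i) x))"
    unfolding sum_subtractf[symmetric] sum_distrib_left
  proof (intro sum.cong refl)
    fix i assume i: "i \<in> I"
    have "of_int (d i) = complex_of_nat (nat (int N - \<bar>d i - int N\<bar>)) -
        of_nat (nat (int N - \<bar>d i - (- int N)\<bar>))"
      using freq[OF i] by (cases "d i \<ge> 0") (auto simp: of_nat_nat)
    moreover have "a * (2 * of_real pi * \<i> * (u - v)) * e = 2 * of_real pi * \<i> * (u * a * e - v * a * e)"
      for a u v e :: complex by (simp add: algebra_simps)
    ultimately show "c i * (2 * of_real pi * \<i> * of_int (d i)) * ee (d i) x = 2 * of_real pi * \<i> *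
        (of_nat (nat (int N - \<bar>d i - int N\<bar>)) * c i * ee (d i) x -
         of_nat (nat (int N - \<bar>d i - (- int N)\<bar>)) * c i * ee (d i) x)"
      by presburger
  qed
  also have "\<dots> = 2 * of_real pi * \<i> * (LINT s|torus. (?K N (x - s) * ?P s - ?K (- N) (x - s) * ?P s))"
    by (subst Bochner_Integration.integral_diff[OF int int])
      (simp only: fejer_shift_coefficient[OF assms(1)])
  finally have eq: "(\<Sum>i\<in>I. c i * (2 * of_real pi * \<i> * of_int (d i)) * ee (d i) x) =
     2 * of_real pi * \<i> * (LINT s|torus. (?K N (x - s) * ?P s - ?K (- N) (x - s) * ?P s))" .
  have "norm (LINT s|torus. (?K N (x - s) * ?P s - ?K (- N) (x - s) * ?P s)) \<le>
      (LINT s|torus. norm (?K N (x - s) * ?P s - ?K (- N) (x - s) * ?P s))"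
    by (rule integral_norm_bound)
  also have "\<dots> \<le> (LINT s|torus. 2 * M * ?D (x - s))"
  proof (rule integral_mono)
    show "integrable torus (\<lambda>s. norm (?K N (x - s) * ?P s - ?K (- N) (x - s) * ?P s))"
      by (intro integrable_norm Bochner_Integration.integrable_diff int)
    show "integrable torus (\<lambda>s. 2 * M * ?D (x - s))"
      by (intro integrable_torus_continuous continuous_intros)
    fix s
    have "norm (?K N (x - s) * ?P s - ?K (- N) (x - s) * ?P s) \<le>
        norm (?K N (x - s) * ?P s) + norm (?K (- N) (x - s) * ?P s)"
      by (rule norm_triangle_ineq4)
    also have "\<dots> = 2 * norm (?P s) * ?D (x - s)"
      unfolding K by (simp add: norm_mult norm_power)
    also have "\<dots> \<le> 2 * M * ?D (x - s)"
      using bnd[of s] by (intro mult_right_mono mult_left_mono) auto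
    finally show "norm (?K N (x - s) * ?P s - ?K (- N) (x - s) * ?P s) \<le> 2 * M * ?D (x - s)" .
  qed
  also have "\<dots> = 2 * M * real N"
    by (simp only: integral_mult_right_zero parseval[OF finite_lessThan]) simp
  finally show ?thesis unfolding eq by (simp add: norm_mult mult_ac)
qed

section \<open>Dyadic averages of Littlewood-Paley blocks\<close>

text \<open>Trigonometric sums with frequencies of size about \<open>2 ^ k\<close>; the block \<open>k = 0\<close> contains the
  constants, hence has no lower bound on its frequencies.\<close>

definition dyadic_block :: "nat \<Rightarrow> (real \<Rightarrow> complex) \<Rightarrow> bool" where
  "dyadic_block k g \<longleftrightarrow> (\<exists>A c. finite A \<and>
     (\<forall>n\<in>A. \<bar>n\<bar> \<le> 2 ^ (k + 1) \<and> (k \<ge> 1 \<longrightarrow> 2 ^ (k - 1) \<le> \<bar>n\<bar>)) \<and>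
     g = (\<lambda>x. \<Sum>n\<in>A. c n * ee n x))"

lemma dyadic_blockE:
  assumes "dyadic_block k g"
  obtains A c where "finite A" "\<And>n. n \<in> A \<Longrightarrow> \<bar>n\<bar> \<le> 2 ^ (k + 1)"
    "\<And>n. n \<in> A \<Longrightarrow> k \<ge> 1 \<Longrightarrow> 2 ^ (k - 1) \<le> \<bar>n\<bar>" "g = (\<lambda>x. \<Sum>n\<in>A. c n * ee n x)"
  using assms unfolding dyadic_block_def by blast

lemma dyadic_block_0: "dyadic_block k (\<lambda>_. 0)"
  unfolding dyadic_block_def by (rule exI[of _ "{}"]) auto

lemma dyadic_block_mult:
  assumes "dyadic_block k g"
  shows "dyadic_block k (\<lambda>x. z * g x)"
proof -
  from assms obtain A c where A: "finite A" "\<And>n. n \<in> A \<Longrightarrow> \<bar>n\<bar> \<le> 2 ^ (k + 1)"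
    "\<And>n. n \<in> A \<Longrightarrow> k \<ge> 1 \<Longrightarrow> 2 ^ (k - 1) \<le> \<bar>n\<bar>" "g = (\<lambda>x. \<Sum>n\<in>A. c n * ee n x)"
    by (rule dyadic_blockE) blast
  then show ?thesis unfolding dyadic_block_def
    by (intro exI[of _ A] exI[of _ "\<lambda>n. z * c n"]) (auto simp: sum_distrib_left mult_ac)
qed

lemma continuous_on_dyadic_block: "dyadic_block k g \<Longrightarrow> continuous_on S g"
  by (erule dyadic_blockE) (simp add: continuous_on_tsum)

lemma dyadic_block_lipschitz:
  assumes "dyadic_block k g" and bnd: "\<And>x. norm (g x) \<le> a"
  shows "norm (g x - g y) \<le> 8 * pi * 2 ^ k * a * \<bar>x - y\<bar>"
proof -
  from assms(1) obtain A c where A: "finite A" "\<And>n. n \<in> A \<Longrightarrow> \<bar>n\<bar> \<le> 2 ^ (k + 1)"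
    "\<And>n. n \<in> A \<Longrightarrow> k \<ge> 1 \<Longrightarrow> 2 ^ (k - 1) \<le> \<bar>n\<bar>" "g = (\<lambda>x. \<Sum>n\<in>A. c n * ee n x)"
    by (rule dyadic_blockE) blast
  let ?g' = "\<lambda>x. \<Sum>n\<in>A. c n * (2 * of_real pi * \<i> * of_int n) * ee n x"
  have "norm (?g' z) \<le> 4 * pi * real (2 ^ (k + 1)) * a" for z
    by (rule bernstein[OF A(1)]) (use A bnd in auto)
  moreover have "4 * pi * real (2 ^ (k + 1)) * a = 8 * pi * 2 ^ k * a" by simp
  ultimately have *: "norm (?g' z) \<le> 8 * pi * 2 ^ k * a" for z by metis
  have "norm (g x - g y) \<le> 8 * pi * 2 ^ k * a * norm (x - y)"
  proof (rule differentiable_bound[of UNIV])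
    show "(g has_derivative (\<lambda>h. h *\<^sub>R ?g' z)) (at z within UNIV)" for z
      using has_vector_derivative_tsum[of c "\<lambda>n. n" A z UNIV] A(4)
      by (simp add: has_vector_derivative_def)
    show "onorm (\<lambda>h. h *\<^sub>R ?g' z) \<le> 8 * pi * 2 ^ k * a" for z
    proof (rule onorm_le)
      fix h :: real
      have "\<bar>h\<bar> * norm (?g' z) \<le> \<bar>h\<bar> * (8 * pi * 2 ^ k * a)"
        by (rule mult_left_mono[OF *]) simp
      then show "norm (h *\<^sub>R ?g' z) \<le> 8 * pi * 2 ^ k * a * norm h"
        by (simp only: norm_scaleR real_norm_def mult.commute)
    qed
  qed auto
  then show ?thesis by simp
qed

text \<open>Since the frequency zero is absent, the block has a periodic antiderivative with the same
  frequencies, to which the reverse Bernstein inequality applies.\<close>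

lemma dyadic_block_antiderivative:
  assumes "dyadic_block k g" and k: "k \<ge> 1" and bnd: "\<And>x. norm (g x) \<le> a"
  obtains F where "\<And>x. (F has_vector_derivative g x) (at x)" "periodic1 F"
    "\<And>x. norm (F x) \<le> 2 * a / 2 ^ k"
proof -
  from assms(1) obtain A c where A: "finite A" "\<And>n. n \<in> A \<Longrightarrow> \<bar>n\<bar> \<le> 2 ^ (k + 1)"
    "\<And>n. n \<in> A \<Longrightarrow> k \<ge> 1 \<Longrightarrow> 2 ^ (k - 1) \<le> \<bar>n\<bar>" "g = (\<lambda>x. \<Sum>n\<in>A. c n * ee n x)"
    by (rule dyadic_blockE) blast
  have nz: "n \<noteq> 0" if "n \<in> A" for n
    using A(3)[OF that k] zero_less_power[of "2::int" "k - 1"] by linarith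
  let ?b = "\<lambda>n. c n / (2 * of_real pi * \<i> * of_int n)"
  have *: "(\<Sum>n\<in>A. ?b n * (2 * of_real pi * \<i> * of_int n) * ee n x) = g x" for x
    unfolding A(4) using nz by (intro sum.cong) auto
  have "norm (\<Sum>n\<in>A. ?b n * ee n x) \<le> a / real (2 ^ (k - 1))" for x
  proof (rule reverse_bernstein[OF A(1)])
    show "norm (\<Sum>n\<in>A. ?b n * (2 * of_real pi * \<i> * of_int n) * ee n x) \<le> a" for x
      unfolding * by (rule bnd)
  qed (use A(3) k in auto)
  moreover have "a / real (2 ^ (k - 1)) = 2 * a / 2 ^ k"
    using k by (cases k) auto
  ultimately show ?thesis
    using has_vector_derivative_tsum[of ?b "\<lambda>n. n" A _ UNIV] periodic1_tsum[of ?b "\<lambda>n. n" A]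
    by (intro that[of "\<lambda>x. \<Sum>n\<in>A. ?b n * ee n x"]) (simp_all only: *)
qed

lemma dyadic_block_integral:
  assumes "dyadic_block k g" and k: "k \<ge> 1" and bnd: "\<And>x. norm (g x) \<le> a" and uv: "u \<le> v"
  shows "norm (integral {u..v} g) \<le> 4 * a / 2 ^ k" and "integral {0..1} g = 0"
proof -
  from dyadic_block_antiderivative[OF assms(1-3)] obtain F where
    F: "\<And>x. (F has_vector_derivative g x) (at x)" "periodic1 F" "\<And>x. norm (F x) \<le> 2 * a / 2 ^ k"
    by blast
  have I: "integral {u..v} g = F v - F u" if "u \<le> v" for u v
    using that F(1)
    by (intro integral_unique fundamental_theorem_of_calculus) (auto intro: has_vector_derivative_at_within)
  have "norm (F v - F u) \<le> norm (F v) + norm (F u)" by (rule norm_triangle_ineq4)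
  then show "norm (integral {u..v} g) \<le> 4 * a / 2 ^ k"
    using F(3)[of u] F(3)[of v] I[OF uv] by simp
  have "F 1 = F 0" using F(2) unfolding periodic1_def by (metis add_0)
  then show "integral {0..1} g = 0" using I[of 0 1] by simp
qed

text \<open>The average of \<open>G\<close> over the \<open>i\<close>-th dyadic interval of length \<open>2 ^ (- j)\<close>.  In \<open>j\<close> these averages form
  a martingale: each is the mean of its two children.\<close>

definition dmean :: "(real \<Rightarrow> complex) \<Rightarrow> nat \<Rightarrow> nat \<Rightarrow> complex" where
  "dmean G j i = 2 ^ j * integral {real i / 2 ^ j..(real i + 1) / 2 ^ j} G"

lemma dmean_split:
  assumes "continuous_on UNIV G"
  shows "dmean G j i = (dmean G (Suc j) (2 * i) + dmean G (Suc j) (2 * i + 1)) / 2"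
proof -
  have e: "real (2 * i) / (2 * 2 ^ j) = real i / 2 ^ j"
    "(real (2 * i) + 1) / (2 * 2 ^ j) = (real i + 1/2) / 2 ^ j"
    "real (2 * i + 1) / (2 * 2 ^ j) = (real i + 1/2) / 2 ^ j"
    "(real (2 * i + 1) + 1) / (2 * 2 ^ j) = (real i + 1) / 2 ^ j"
    by (simp_all add: field_simps)
  have alg: "p * z = (2 * p * x + 2 * p * y) / 2" if "x + y = z" for p x y z :: complex
    using that by (auto simp: algebra_simps)
  have "integral {real i / 2 ^ j..(real i + 1/2) / 2 ^ j} G + integral {(real i + 1/2) / 2 ^ j..(real i + 1) / 2 ^ j} G
     = integral {real i / 2 ^ j..(real i + 1) / 2 ^ j} G"
    by (rule Henstock_Kurzweil_Integration.integral_combine)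
      (auto intro!: divide_right_mono integrable_continuous_real continuous_on_subset[OF assms])
  then show ?thesis
    unfolding dmean_def power_Suc e by (rule alg)
qed

lemma dmean_sum:
  assumes "\<And>k. k \<in> A \<Longrightarrow> continuous_on UNIV (g k)"
  shows "dmean (\<lambda>x. \<Sum>k\<in>A. g k x) j i = (\<Sum>k\<in>A. dmean (g k) j i)"
proof (cases "finite A")
  case True
  have "integral S (\<lambda>x. \<Sum>k\<in>A. g k x) = (\<Sum>k\<in>A. integral S (g k))"
    if "S = {real i / 2 ^ j..(real i + 1) / 2 ^ j}" for S
    using True that
    by (intro integral_sum) (auto intro!: integrable_continuous_real continuous_on_subset[OF assms])
  then show ?thesis by (simp add: dmean_def sum_distrib_left)
qed (simp add: dmean_def)

text \<open>Adjacent averages of a block almost agree at scales finer than its wave length, by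
  smoothness, and almost vanish at coarser scales, by cancellation.\<close>

lemma dyadic_block_dmean:
  assumes "dyadic_block k g" and bnd: "\<And>x. norm (g x) \<le> a"
  shows "norm (dmean g (Suc j) (2 * i) - dmean g (Suc j) (2 * i + 1)) \<le> 16 * a * (1 / 2) ^ ((j - k) + (k - j))"
proof (cases "k \<le> j")
  case True
  define h :: real where "h = 1 / 2 ^ Suc j"
  define u where "u = real (2 * i) / 2 ^ Suc j"
  have h: "h > 0" by (simp add: h_def)
  have a: "a \<ge> 0" using bnd[of 0] norm_ge_zero order_trans by blast
  have cg: "continuous_on S g" for S by (rule continuous_on_dyadic_block[OF assms(1)])
  have cgh: "continuous_on S (\<lambda>x. g (x + h))" for S
    by (rule continuous_on_compose2[OF cg[of UNIV]]) (auto intro: continuous_intros)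
  have int: "g integrable_on {x..y}" "(\<lambda>x. g (x + h)) integrable_on {x..y}" for x y
    by (rule integrable_continuous_real[OF cg] integrable_continuous_real[OF cgh])+
  have e: "(real (2 * i) + 1) / 2 ^ Suc j = u + h" "real (2 * i + 1) / 2 ^ Suc j = u + h"
    "(real (2 * i + 1) + 1) / 2 ^ Suc j = u + h + h"
    by (simp_all add: u_def h_def field_simps)
  have "integral {u + h..u + h + h} g = integral {u..u + h} (\<lambda>x. g (x + h))"
    unfolding integral_shift[OF cg, symmetric] o_def ..
  then have "dmean g (Suc j) (2 * i) - dmean g (Suc j) (2 * i + 1) =
      2 ^ Suc j * integral {u..u + h} (\<lambda>x. g x - g (x + h))"
    unfolding dmean_def e u_def[symmetric]
    by (subst integral_diff[OF int]) (simp add: algebra_simps)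
  moreover have "norm (integral {u..u + h} (\<lambda>x. g x - g (x + h))) \<le> (8 * pi * 2 ^ k * a * h) * (u + h - u)"
  proof (rule integral_bound)
    show "continuous_on {u..u + h} (\<lambda>x. g x - g (x + h))"
      by (rule continuous_on_diff[OF cg cgh])
    show "norm (g x - g (x + h)) \<le> 8 * pi * 2 ^ k * a * h" for x
      using dyadic_block_lipschitz[OF assms, of x "x + h"] h by simp
  qed (use h in auto)
  ultimately have "norm (dmean g (Suc j) (2 * i) - dmean g (Suc j) (2 * i + 1)) \<le>
      2 ^ Suc j * ((8 * pi * 2 ^ k * a * h) * (u + h - u))"
    by (simp only: norm_mult norm_power norm_numeral) (rule mult_left_mono, auto)
  also have "\<dots> = 4 * pi * a * (2 ^ k / 2 ^ j)"
    by (simp add: h_def field_simps)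
  also have "(2::real) ^ k / 2 ^ j = (1 / 2) ^ ((j - k) + (k - j))"
    using True by (simp add: power_diff power_one_over)
  also have "4 * pi * a * (1 / 2) ^ ((j - k) + (k - j)) \<le> 16 * a * (1 / 2) ^ ((j - k) + (k - j))"
    using pi_less_4 a by (intro mult_right_mono) auto
  finally show ?thesis .
next
  case False
  then have k: "k \<ge> 1" "j < k" by auto
  have *: "norm (dmean g (Suc j) m) \<le> 2 ^ Suc j * (4 * a / 2 ^ k)" for m
  proof -
    have "norm (integral {real m / 2 ^ Suc j..(real m + 1) / 2 ^ Suc j} g) \<le> 4 * a / 2 ^ k"
      by (rule dyadic_block_integral[OF assms(1) k(1) bnd]) (simp add: divide_right_mono)
    then have "2 ^ Suc j * norm (integral {real m / 2 ^ Suc j..(real m + 1) / 2 ^ Suc j} g) \<le>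
        2 ^ Suc j * (4 * a / 2 ^ k)"
      by (rule mult_left_mono) simp
    then show ?thesis by (simp only: dmean_def norm_mult norm_power norm_numeral)
  qed
  have "norm (dmean g (Suc j) (2 * i) - dmean g (Suc j) (2 * i + 1)) \<le> 2 * (2 ^ Suc j * (4 * a / 2 ^ k))"
    unfolding mult_2[of "2 ^ Suc j * (4 * a / 2 ^ k)"]
    by (rule order_trans[OF norm_triangle_ineq4 add_mono[OF * *]])
  also have "\<dots> = 16 * a * (2 ^ j / 2 ^ k)" by simp
  also have "(2::real) ^ j / 2 ^ k = (1 / 2) ^ ((j - k) + (k - j))"
    using k by (simp add: power_diff power_one_over)
  finally show ?thesis .
qed

section \<open>Exponential integrability\<close>

text \<open>For \<open>\<bar>d\<bar> \<le> 1\<close> this follows from \<open>cosh d \<le> 1 + d\<^sup>2\<close> and \<open>d\<^sup>2 \<le> \<bar>d\<bar> powr q\<close>, for \<open>\<bar>d\<bar> \<ge> 1\<close> from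
  \<open>cosh d \<le> exp \<bar>d\<bar>\<close> and \<open>\<bar>d\<bar> \<le> \<bar>d\<bar> powr q\<close>: the first regime uses \<open>q \<le> 2\<close>, the second
  \<open>q \<ge> 1\<close>.\<close>

lemma cosh_le_exp_powr:
  fixes d q :: real
  assumes "1 \<le> q" "q \<le> 2"
  shows "cosh d \<le> exp (\<bar>d\<bar> powr q)"
proof -
  have nn: "cosh d \<le> exp (d powr q)" if d: "d \<ge> 0" for d :: real
  proof (cases "d \<le> 1")
    case True
    have "exp d \<le> 1 + d + d\<^sup>2" by (rule exp_bound) (use d True in auto)
    moreover have "exp (- d) \<le> 1 - d + d\<^sup>2"
    proof -
      have "1 \<le> (1 + d) * (1 - d + d\<^sup>2)" using d by (simp add: algebra_simps power2_eq_square)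
      also have "\<dots> \<le> exp d * (1 - d + d\<^sup>2)"
        using exp_ge_add_one_self[of d] d True by (intro mult_right_mono) auto
      finally show ?thesis by (simp add: exp_minus field_simps)
    qed
    ultimately have "cosh d \<le> 1 + d\<^sup>2" by (simp add: cosh_def)
    also have "\<dots> \<le> exp (d\<^sup>2)" by (rule exp_ge_add_one_self)
    also have "d\<^sup>2 \<le> d powr q"
      using powr_mono'[OF assms(2) d True] d by (cases "d = 0") (auto simp: powr_numeral)
    finally show ?thesis by simp
  next
    case False
    have "cosh d \<le> exp d" using d by (simp add: cosh_def)
    also have "d \<le> d powr q" using powr_mono[OF assms(1), of d] False by simp
    finally show ?thesis by simp
  qed
  have "cosh d = cosh \<bar>d\<bar>" by (simp add: abs_if)
  then show ?thesis using nn[of "\<bar>d\<bar>"] by simp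
qed

lemma sum_pairs: "(\<Sum>i<2 * n. f i) = (\<Sum>i<n. f (2 * i) + f (2 * i + 1))" for f :: "nat \<Rightarrow> 'a::comm_monoid_add"
  by (induction n) (auto simp: add.assoc)

text \<open>The exponential moment of the real part of the dyadic martingale at generation \<open>j\<close>.\<close>

definition dexp :: "(real \<Rightarrow> complex) \<Rightarrow> nat \<Rightarrow> real" where
  "dexp G j = (\<Sum>i<2 ^ j. exp (Re (dmean G j i))) / 2 ^ j"

lemma dexp_nonneg: "dexp G j \<ge> 0"
  by (simp add: dexp_def sum_nonneg)

text \<open>One step of the Azuma-Hoeffding argument: two children with values \<open>m + d\<close> and \<open>m - d\<close> have
  \<open>exp m * cosh d\<close> as the mean of their exponentials.\<close>

lemma dexp_Suc_le:
  assumes q: "1 \<le> q" "q \<le> 2" and G: "continuous_on UNIV G"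
    and b: "\<And>i. norm (dmean G (Suc j) (2 * i) - dmean G (Suc j) (2 * i + 1)) \<le> 2 * b"
  shows "dexp G (Suc j) \<le> exp (b powr q) * dexp G j"
proof -
  have "exp (Re (dmean G (Suc j) (2 * i))) + exp (Re (dmean G (Suc j) (2 * i + 1))) \<le>
      2 * exp (b powr q) * exp (Re (dmean G j i))" for i
  proof -
    define u v where "u = Re (dmean G (Suc j) (2 * i))" and "v = Re (dmean G (Suc j) (2 * i + 1))"
    have m: "Re (dmean G j i) = (u + v) / 2"
      unfolding u_def v_def dmean_split[OF G, of j i] by simp
    have "\<bar>u - v\<bar> \<le> 2 * b"
      using order_trans[OF abs_Re_le_cmod b[of i]] by (simp add: u_def v_def)
    then have d: "\<bar>(u - v) / 2\<bar> \<le> b" by simp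
    have "exp u + exp v = 2 * exp ((u + v) / 2) * cosh ((u - v) / 2)"
      by (simp add: cosh_def algebra_simps exp_add[symmetric] diff_divide_distrib add_divide_distrib)
    also have "\<dots> \<le> 2 * exp ((u + v) / 2) * exp (\<bar>(u - v) / 2\<bar> powr q)"
      by (intro mult_left_mono cosh_le_exp_powr q) auto
    also have "\<dots> \<le> 2 * exp ((u + v) / 2) * exp (b powr q)"
      using d q by (intro mult_left_mono) (auto intro: powr_mono2)
    finally show ?thesis unfolding m u_def v_def by (simp add: mult_ac)
  qed
  then have "(\<Sum>i<2 * 2 ^ j. exp (Re (dmean G (Suc j) i))) \<le>
      (\<Sum>i<2 ^ j. 2 * exp (b powr q) * exp (Re (dmean G j i)))"
    unfolding sum_pairs by (intro sum_mono)
  then show ?thesis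
    by (simp add: dexp_def sum_distrib_left[symmetric] field_simps)
qed

lemma dexp_le:
  assumes q: "1 \<le> q" "q \<le> 2" and G: "continuous_on UNIV G"
    and b: "\<And>j i. norm (dmean G (Suc j) (2 * i) - dmean G (Suc j) (2 * i + 1)) \<le> 2 * b j"
  shows "dexp G J \<le> exp (Re (integral {0..1} G) + (\<Sum>j<J. b j powr q))"
proof (induction J)
  case 0
  then show ?case by (simp add: dexp_def dmean_def)
next
  case (Suc J)
  have "dexp G (Suc J) \<le> exp (b J powr q) * dexp G J"
    by (rule dexp_Suc_le[OF q G b])
  also have "\<dots> \<le> exp (b J powr q) * exp (Re (integral {0..1} G) + (\<Sum>j<J. b j powr q))"
    by (rule mult_left_mono[OF Suc]) simp
  finally show ?case by (simp add: exp_add[symmetric] add_ac)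
qed

lemma integral_equal_pieces:
  fixes f :: "real \<Rightarrow> real"
  assumes "continuous_on UNIV f" "h > 0"
  shows "integral {0..real n * h} f = (\<Sum>i<n. integral {real i * h..(real i + 1) * h} f)"
proof (induction n)
  case (Suc n)
  have "integral {0..real n * h} f + integral {real n * h..real (Suc n) * h} f = integral {0..real (Suc n) * h} f"
    by (rule Henstock_Kurzweil_Integration.integral_combine)
      (use assms(2) in \<open>auto intro!: integrable_continuous_real continuous_on_subset[OF assms(1)] mult_right_mono\<close>)
  then show ?case using Suc by (simp add: add.commute)
qed simp

text \<open>Jensen's inequality goes the other way.  As \<open>G\<close> is Lipschitz, it exceeds its average over an
  interval of length \<open>2 ^ (- j)\<close> by at most \<open>B / 2 ^ j\<close>, which is harmless for large \<open>j\<close>.\<close>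

lemma integral_exp_le_dexp:
  assumes G: "continuous_on UNIV G" and lip: "\<And>x y. norm (G x - G y) \<le> B * \<bar>x - y\<bar>"
  shows "integral {0..1} (\<lambda>x. exp (Re (G x))) \<le> exp (B / 2 ^ j) * dexp G j"
proof -
  define h :: real where "h = 1 / 2 ^ j"
  have h: "h > 0" by (simp add: h_def)
  have B: "B \<ge> 0" using order_trans[OF norm_ge_zero lip[of 0 1]] by simp
  have cexp: "continuous_on UNIV (\<lambda>x. exp (Re (G x)))" by (intro continuous_intros G)
  have piece: "integral {real i * h..(real i + 1) * h} (\<lambda>x. exp (Re (G x))) \<le>
      exp (B * h) * exp (Re (dmean G j i)) * h" for i
  proof -
    let ?I = "{real i * h..(real i + 1) * h}"
    have le: "real i * h \<le> (real i + 1) * h" using h by (simp add: algebra_simps)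
    have "Re (G x) \<le> Re (dmean G j i) + B * h" if x: "x \<in> ?I" for x
    proof -
      have "integral ?I (\<lambda>y. G x - G y) = integral ?I (\<lambda>y. G x) - integral ?I G"
        by (intro integral_diff integrable_continuous_real continuous_on_subset[OF G] continuous_intros) auto
      also have "integral ?I (\<lambda>y. G x) = h * G x"
        using le by (simp add: scaleR_conv_of_real algebra_simps)
      finally have *: "2 ^ j * integral ?I (\<lambda>y. G x - G y) = G x - dmean G j i"
        unfolding dmean_def by (simp add: h_def algebra_simps divide_simps)
      have "norm (integral ?I (\<lambda>y. G x - G y)) \<le> (B * h) * ((real i + 1) * h - real i * h)"
      proof (rule integral_bound[OF le])
        show "continuous_on ?I (\<lambda>y. G x - G y)"
          by (intro continuous_intros continuous_on_subset[OF G]) auto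
        fix y assume "y \<in> ?I"
        then have "\<bar>x - y\<bar> \<le> h" using x by (auto simp: algebra_simps)
        then show "norm (G x - G y) \<le> B * h"
          using lip[of x y] mult_left_mono[of "\<bar>x - y\<bar>" h B] B by linarith
      qed
      also have "\<dots> = B * h * h" by (simp add: algebra_simps)
      finally have "norm (integral ?I (\<lambda>y. G x - G y)) \<le> B * h * h" .
      then have "norm (G x - dmean G j i) \<le> 2 ^ j * (B * h * h)"
        unfolding *[symmetric] by (simp add: norm_mult norm_power)
      also have "\<dots> = B * h" by (simp add: h_def)
      finally have "Re (G x - dmean G j i) \<le> B * h"
        using complex_Re_le_cmod order_trans by blast
      then show ?thesis by simp
    qed
    then have "exp (Re (G x)) \<le> exp (B * h) * exp (Re (dmean G j i))" if "x \<in> ?I" for x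
      using that by (simp add: exp_add[symmetric] add.commute)
    then have "integral ?I (\<lambda>x. exp (Re (G x))) \<le> integral ?I (\<lambda>x. exp (B * h) * exp (Re (dmean G j i)))"
      by (intro integral_le integrable_continuous_real continuous_on_subset[OF cexp]) (auto intro: continuous_intros)
    also have "\<dots> = exp (B * h) * exp (Re (dmean G j i)) * h"
      using le by (simp add: algebra_simps)
    finally show ?thesis .
  qed
  have "integral {0..1} (\<lambda>x. exp (Re (G x))) =
      (\<Sum>i<2 ^ j. integral {real i * h..(real i + 1) * h} (\<lambda>x. exp (Re (G x))))"
    using integral_equal_pieces[OF cexp h, of "2 ^ j"] by (simp add: h_def)
  also have "\<dots> \<le> (\<Sum>i<2 ^ j. exp (B * h) * exp (Re (dmean G j i)) * h)"
    by (intro sum_mono piece)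
  also have "\<dots> = exp (B / 2 ^ j) * dexp G j"
    by (simp add: dexp_def h_def sum_distrib_left sum_divide_distrib)
  finally show ?thesis .
qed

text \<open>The two geometric tails of \<open>(3/4) ^ \<bar>j - k\<bar>\<close>, tracked by an exact invariant: the part
  \<open>k < j\<close> sums to at most \<open>3\<close> and the part \<open>k \<ge> j\<close> to at most \<open>4\<close>.\<close>

lemma two_sided_geometric_sum:
  "(\<Sum>k<n. (3 / 4 :: real) ^ ((j - k) + (k - j))) \<le> 7"
proof -
  have "(\<Sum>k<n. (3 / 4 :: real) ^ ((j - k) + (k - j))) \<le>
      (if n \<le> j then 3 * (3 / 4) ^ (j - n) else 7 - 4 * (3 / 4) ^ (n - j))"
  proof (induction n)
    case (Suc n)
    consider "Suc n \<le> j" | "n = j" | "n > j" by linarith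
    then show ?case
    proof cases
      case 1
      then have "(3 / 4 :: real) ^ (j - n) = 3 / 4 * (3 / 4) ^ (j - Suc n)"
        by (metis Suc_diff_Suc Suc_le_lessD power_Suc)
      then show ?thesis using Suc 1 by simp
    next
      case 3
      then have "(3 / 4 :: real) ^ (Suc n - j) = 3 / 4 * (3 / 4) ^ (n - j)"
        by (simp add: Suc_diff_le)
      then show ?thesis using Suc 3 by simp
    qed (use Suc in simp)
  qed simp
  also have "\<dots> \<le> 7"
    using power_le_one[of "3/4::real" "j - n"] zero_le_power[of "3/4::real" "n - j"] by auto
  finally show ?thesis .
qed

text \<open>Discrete Young inequality for the kernel \<open>2 ^ (- \<bar>j - k\<bar>)\<close>.  As \<open>1/2 \<le> (3/4)\<^sup>2\<close>, half of
  the decay bounds the sum by a maximum and the other half is kept for the summation over \<open>j\<close>.\<close>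

lemma geometric_young:
  fixes a :: "nat \<Rightarrow> real"
  assumes q: "1 \<le> q" "q \<le> 2" and a: "\<And>k. k \<le> K \<Longrightarrow> a k \<ge> 0"
  shows "(\<Sum>j<J. (8 * (\<Sum>k\<le>K. a k * (1 / 2) ^ ((j - k) + (k - j)))) powr q) \<le>
    21952 * (\<Sum>k\<le>K. a k powr q)"
proof -
  define r :: "nat \<Rightarrow> nat \<Rightarrow> real" where "r j k = (3 / 4) ^ ((j - k) + (k - j))" for j k
  have r: "0 \<le> r j k" "r j k \<le> 1" for j k by (simp_all add: r_def power_le_one)
  have half: "(1 / 2) ^ ((j - k) + (k - j)) \<le> r j k * r j k" for j k
    unfolding r_def power_mult_distrib[symmetric] by (rule power_mono) auto
  have step: "(8 * (\<Sum>k\<le>K. a k * (1 / 2) ^ ((j - k) + (k - j)))) powr q \<le>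
      3136 * (\<Sum>k\<le>K. r j k * a k powr q)" for j
  proof -
    define m where "m = Max ((\<lambda>k. r j k * a k) ` {..K})"
    have m_ge: "r j k * a k \<le> m" if "k \<le> K" for k
      unfolding m_def using that by (intro Max_ge) auto
    obtain k0 where k0: "k0 \<le> K" "m = r j k0 * a k0"
    proof -
      have "m \<in> (\<lambda>k. r j k * a k) ` {..K}" unfolding m_def by (rule Max_in) auto
      then show ?thesis using that by auto
    qed
    have m0: "m \<ge> 0" using k0 a r by simp
    have "(\<Sum>k\<le>K. a k * (1 / 2) ^ ((j - k) + (k - j))) \<le> (\<Sum>k\<le>K. r j k * m)"
    proof (rule sum_mono)
      fix k assume k: "k \<in> {..K}"
      have "a k * (1 / 2) ^ ((j - k) + (k - j)) \<le> a k * (r j k * r j k)"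
        by (rule mult_left_mono[OF half]) (use a k in auto)
      also have "\<dots> = r j k * (r j k * a k)" by simp
      also have "\<dots> \<le> r j k * m" by (rule mult_left_mono) (use m_ge k r in auto)
      finally show "a k * (1 / 2) ^ ((j - k) + (k - j)) \<le> r j k * m" .
    qed
    also have "\<dots> = (\<Sum>k<Suc K. r j k) * m" by (simp only: sum_distrib_right lessThan_Suc_atMost)
    also have "\<dots> \<le> 7 * m"
      unfolding r_def by (intro mult_right_mono two_sided_geometric_sum m0)
    finally have "8 * (\<Sum>k\<le>K. a k * (1 / 2) ^ ((j - k) + (k - j))) \<le> 56 * m" by simp
    then have "(8 * (\<Sum>k\<le>K. a k * (1 / 2) ^ ((j - k) + (k - j)))) powr q \<le> (56 * m) powr q"
      using q a by (intro powr_mono2) (auto intro!: sum_nonneg)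
    also have "\<dots> = 56 powr q * m powr q" using m0 by (simp add: powr_mult)
    also have "\<dots> \<le> 3136 * m powr q"
      using powr_mono[OF q(2), of 56] by (intro mult_right_mono) (auto simp: powr_numeral)
    also have "m powr q = r j k0 powr q * a k0 powr q"
      unfolding k0(2) using r a k0 by (simp add: powr_mult)
    also have "r j k0 powr q \<le> r j k0"
      using powr_mono'[OF q(1) r(1)[of j k0] r(2)[of j k0]] r(1)[of j k0] by simp
    also have "r j k0 * a k0 powr q \<le> (\<Sum>k\<le>K. r j k * a k powr q)"
      by (rule member_le_sum) (use k0 r in auto)
    finally show ?thesis by (simp add: mult_right_mono)
  qed
  have "(\<Sum>j<J. (8 * (\<Sum>k\<le>K. a k * (1 / 2) ^ ((j - k) + (k - j)))) powr q) \<le>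
      (\<Sum>j<J. 3136 * (\<Sum>k\<le>K. r j k * a k powr q))"
    by (intro sum_mono step)
  also have "\<dots> = 3136 * (\<Sum>k\<le>K. (\<Sum>j<J. r j k) * a k powr q)"
    unfolding sum_distrib_left[symmetric] by (subst sum.swap) (simp only: sum_distrib_right)
  also have "\<dots> \<le> 3136 * (\<Sum>k\<le>K. 7 * a k powr q)"
  proof (intro mult_left_mono sum_mono mult_right_mono)
    show "(\<Sum>j<J. r j k) \<le> 7" for k
      using two_sided_geometric_sum[of k J] by (simp add: r_def add.commute)
  qed auto
  finally show ?thesis by (simp add: sum_distrib_left[symmetric])
qed

text \<open>Only the mean of the zeroth block survives in \<open>\<integral> G\<close>, and it is at most \<open>1 + a\<^sub>0 powr q\<close>.
  The martingale steps contribute \<open>21952\<close> times the sum, which leaves room for the term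
  \<open>a\<^sub>0 powr q\<close>; the two units in the exponent are the \<open>1\<close> above and the Lipschitz error at a
  generation \<open>J\<close> with \<open>B < 2 ^ J\<close>.\<close>

lemma exp_integral_blocks:
  assumes q: "1 \<le> q" "q \<le> 2"
    and blk: "\<And>k. k \<le> K \<Longrightarrow> dyadic_block k (g k)"
    and bnd: "\<And>k x. k \<le> K \<Longrightarrow> norm (g k x) \<le> a k"
  shows "integral {0..1} (\<lambda>x. exp (Re (\<Sum>k\<le>K. g k x))) \<le> exp (2 + 22000 * (\<Sum>k\<le>K. a k powr q))"
proof -
  define G where "G x = (\<Sum>k\<le>K. g k x)" for x
  have a: "a k \<ge> 0" if "k \<le> K" for k using bnd[OF that, of 0] norm_ge_zero order_trans by blast
  have cont: "continuous_on S (g k)" if "k \<le> K" for S k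
    using continuous_on_dyadic_block[OF blk[OF that]] .
  have G: "continuous_on UNIV G" unfolding G_def by (intro continuous_intros cont) auto
  define B where "B = (\<Sum>k\<le>K. 8 * pi * 2 ^ k * a k)"
  have lip: "norm (G x - G y) \<le> B * \<bar>x - y\<bar>" for x y
  proof -
    have "norm (G x - G y) \<le> (\<Sum>k\<le>K. norm (g k x - g k y))"
      unfolding G_def sum_subtractf[symmetric] by (rule norm_sum)
    also have "\<dots> \<le> (\<Sum>k\<le>K. 8 * pi * 2 ^ k * a k * \<bar>x - y\<bar>)"
      by (intro sum_mono dyadic_block_lipschitz blk bnd) auto
    finally show ?thesis by (simp add: B_def sum_distrib_right)
  qed
  define b where "b j = 8 * (\<Sum>k\<le>K. a k * (1 / 2) ^ ((j - k) + (k - j)))" for j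
  have b: "norm (dmean G (Suc j) (2 * i) - dmean G (Suc j) (2 * i + 1)) \<le> 2 * b j" for j i
  proof -
    have "dmean G (Suc j) (2 * i) - dmean G (Suc j) (2 * i + 1) =
        (\<Sum>k\<le>K. dmean (g k) (Suc j) (2 * i) - dmean (g k) (Suc j) (2 * i + 1))"
      unfolding G_def sum_subtractf by (subst (1 2) dmean_sum) (use cont in auto)
    also have "norm \<dots> \<le> (\<Sum>k\<le>K. 16 * a k * (1 / 2) ^ ((j - k) + (k - j)))"
      by (intro order_trans[OF norm_sum] sum_mono dyadic_block_dmean blk bnd) auto
    finally show ?thesis by (simp add: b_def sum_distrib_left mult_ac)
  qed
  have mean: "Re (integral {0..1} G) \<le> 1 + (\<Sum>k\<le>K. a k powr q)"
  proof -
    have "integral {0..1} G = (\<Sum>k\<le>K. integral {0..1} (g k))"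
      unfolding G_def using cont by (intro integral_sum integrable_continuous_real) auto
    also have "\<dots> = (\<Sum>k\<in>{0}. integral {0..1} (g k))"
      by (rule sum.mono_neutral_right)
        (auto intro!: dyadic_block_integral(2)[OF blk _ bnd, of _ 0 0])
    finally have "norm (integral {0..1} G) = norm (integral {0..1} (g 0))" by simp
    also have "\<dots> \<le> a 0 * (1 - 0)"
      by (rule integral_bound) (use cont bnd in auto)
    also have "\<dots> \<le> 1 + a 0 powr q"
    proof (cases "a 0 \<le> 1")
      case False
      then show ?thesis using powr_mono[OF q(1), of "a 0"] by simp
    qed (simp add: add_increasing2)
    also have "a 0 powr q \<le> (\<Sum>k\<le>K. a k powr q)" by (rule member_le_sum) auto
    finally show ?thesis using complex_Re_le_cmod order_trans by (metis add_le_cancel_left)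
  qed
  obtain J :: nat where J: "B < 2 ^ J" using real_arch_pow[of 2 B] by auto
  have "integral {0..1} (\<lambda>x. exp (Re (G x))) \<le> exp (B / 2 ^ J) * dexp G J"
    by (rule integral_exp_le_dexp[OF G lip])
  also have "\<dots> \<le> exp 1 * exp (Re (integral {0..1} G) + (\<Sum>j<J. b j powr q))"
    using J by (intro mult_mono dexp_le[OF q G b] dexp_nonneg) (auto simp: divide_simps)
  also have "\<dots> \<le> exp (2 + 22000 * (\<Sum>k\<le>K. a k powr q))"
    using mean geometric_young[where a = a and J = J and K = K, OF q a] sum_nonneg[of "{..K}" "\<lambda>k. a k powr q"]
    unfolding exp_add[symmetric] b_def by simp
  finally show ?thesis by (simp add: G_def)
qed

text \<open>The modulus is at most twice the largest of the real parts of \<open>G\<close>, \<open>- G\<close>, \<open>\<i> G\<close> and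
  \<open>- \<i> G\<close>, and each of these is again a sum of blocks.\<close>

lemma exp_norm_integral_blocks:
  assumes q: "1 \<le> q" "q \<le> 2" and lam: "\<theta> > 0"
    and blk: "\<And>k. k \<le> K \<Longrightarrow> dyadic_block k (g k)"
    and bnd: "\<And>k x. k \<le> K \<Longrightarrow> norm (g k x) \<le> a k"
  shows "(LINT x|torus. exp (\<theta> / 2 * norm (\<Sum>k\<le>K. g k x))) \<le>
    4 * exp (2 + 22000 * (\<theta> powr q * (\<Sum>k\<le>K. a k powr q)))"
proof -
  let ?G = "\<lambda>x. \<Sum>k\<le>K. g k x"
  define Z :: "complex set" where "Z = {1, -1, \<i>, -\<i>}"
  have "card Z = 4" by (simp add: Z_def complex_eq_iff)
  have a: "a k \<ge> 0" if "k \<le> K" for k using bnd[OF that, of 0] norm_ge_zero order_trans by blast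
  have G: "continuous_on S ?G" for S
    by (intro continuous_on_sum) (rule continuous_on_dyadic_block[OF blk], simp)
  have int: "integrable torus (\<lambda>x. exp (\<theta> * Re (z * ?G x)))" for z
    by (intro integrable_torus_continuous continuous_intros G)
  have one: "(LINT x|torus. exp (\<theta> * Re (z * ?G x))) \<le>
      exp (2 + 22000 * (\<theta> powr q * (\<Sum>k\<le>K. a k powr q)))" if "z \<in> Z" for z
  proof -
    have "(LINT x|torus. exp (\<theta> * Re (z * ?G x))) = integral {0..1} (\<lambda>x. exp (\<theta> * Re (z * ?G x)))"
      by (intro integrable_torus_continuous continuous_intros G)
    also have "\<dots> = integral {0..1} (\<lambda>x. exp (Re (\<Sum>k\<le>K. (of_real \<theta> * z) * g k x)))"
      by (simp add: sum_distrib_left[symmetric] mult.assoc)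
    also have "\<dots> \<le> exp (2 + 22000 * (\<Sum>k\<le>K. (\<theta> * a k) powr q))"
    proof (rule exp_integral_blocks[OF q])
      show "dyadic_block k (\<lambda>x. (of_real \<theta> * z) * g k x)" if "k \<le> K" for k
        by (intro dyadic_block_mult blk that)
      show "norm ((of_real \<theta> * z) * g k x) \<le> \<theta> * a k" if "k \<le> K" for k x
        using bnd[OF that, of x] lam \<open>z \<in> Z\<close> by (auto simp: norm_mult Z_def)
    qed
    also have "(\<Sum>k\<le>K. (\<theta> * a k) powr q) = \<theta> powr q * (\<Sum>k\<le>K. a k powr q)"
      using a lam by (simp add: powr_mult sum_distrib_left)
    finally show ?thesis .
  qed
  have "(LINT x|torus. exp (\<theta> / 2 * norm (?G x))) \<le> (LINT x|torus. (\<Sum>z\<in>Z. exp (\<theta> * Re (z * ?G x))))"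
  proof (rule integral_mono)
    show "integrable torus (\<lambda>x. exp (\<theta> / 2 * norm (?G x)))"
      by (intro integrable_torus_continuous continuous_intros G)
    show "integrable torus (\<lambda>x. \<Sum>z\<in>Z. exp (\<theta> * Re (z * ?G x)))"
      by (intro Bochner_Integration.integrable_sum int)
    fix x
    have "\<exists>z\<in>Z. norm (?G x) \<le> 2 * Re (z * ?G x)"
      using cmod_le[of "?G x"] unfolding Z_def
      by (auto simp: abs_if split: if_splits)
    then obtain z where z: "z \<in> Z" "norm (?G x) \<le> 2 * Re (z * ?G x)" by blast
    have "exp (\<theta> / 2 * norm (?G x)) \<le> exp (\<theta> / 2 * (2 * Re (z * ?G x)))"
      unfolding exp_le_cancel_iff by (rule mult_left_mono[OF z(2)]) (use lam in simp)
    also have "\<dots> = exp (\<theta> * Re (z * ?G x))" by simp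
    also have "\<dots> \<le> (\<Sum>z\<in>Z. exp (\<theta> * Re (z * ?G x)))"
      by (rule member_le_sum[OF z(1)]) (auto simp: Z_def)
    finally show "exp (\<theta> / 2 * norm (?G x)) \<le> (\<Sum>z\<in>Z. exp (\<theta> * Re (z * ?G x)))" .
  qed
  also have "\<dots> = (\<Sum>z\<in>Z. LINT x|torus. exp (\<theta> * Re (z * ?G x)))"
    by (rule Bochner_Integration.integral_sum) (rule int)
  also have "\<dots> \<le> real (card Z) * exp (2 + 22000 * (\<theta> powr q * (\<Sum>k\<le>K. a k powr q)))"
    by (rule sum_bounded_above) (rule one)
  finally show ?thesis using \<open>card Z = 4\<close> by simp
qed

lemma blocks_tail:
  assumes q: "1 \<le> q" "q \<le> 2" and lam: "\<theta> > 0"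
    and blk: "\<And>k. k \<le> K \<Longrightarrow> dyadic_block k (g k)"
    and bnd: "\<And>k x. k \<le> K \<Longrightarrow> norm (g k x) \<le> a k"
    and a: "(\<Sum>k\<le>K. a k powr q) \<le> 1"
  shows "measure torus {x \<in> {0..<1}. norm (\<Sum>k\<le>K. g k x) > s} \<le>
    4 * exp (2 + 22000 * \<theta> powr q - \<theta> / 2 * s)"
proof -
  let ?G = "\<lambda>x. \<Sum>k\<le>K. g k x"
  interpret finite_measure torus by (rule finite_measure_torus)
  have G: "continuous_on S ?G" for S
    by (intro continuous_on_sum) (rule continuous_on_dyadic_block[OF blk], simp)
  have int: "integrable torus (\<lambda>x. exp (\<theta> / 2 * norm (?G x)))"
    by (intro integrable_torus_continuous continuous_intros G)
  have sub: "{x \<in> {0..<1}. norm (?G x) > s} \<subseteq>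
      {x \<in> space torus. exp (\<theta> / 2 * norm (?G x)) \<ge> exp (\<theta> / 2 * s)}"
    using lam by (auto intro!: mult_left_mono)
  have meas: "(\<lambda>x. exp (\<theta> / 2 * norm (?G x))) \<in> borel_measurable torus"
    using int by (rule borel_measurable_integrable)
  have "{x \<in> space torus. exp (\<theta> / 2 * norm (?G x)) \<ge> exp (\<theta> / 2 * s)} \<in> sets torus"
    using meas by measurable
  then have "measure torus {x \<in> {0..<1}. norm (?G x) > s} \<le>
      measure torus {x \<in> space torus. exp (\<theta> / 2 * norm (?G x)) \<ge> exp (\<theta> / 2 * s)}"
    by (rule finite_measure_mono[OF sub])
  also have "\<dots> \<le> (LINT x|torus. exp (\<theta> / 2 * norm (?G x))) / exp (\<theta> / 2 * s)"
    using integral_Markov_inequality_measure[OF int, of "space torus" "exp (\<theta> / 2 * s)"] by simp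
  also have "\<dots> \<le> 4 * exp (2 + 22000 * (\<theta> powr q * (\<Sum>k\<le>K. a k powr q))) / exp (\<theta> / 2 * s)"
    by (intro divide_right_mono exp_norm_integral_blocks[OF q lam blk bnd]) auto
  also have "\<dots> \<le> 4 * exp (2 + 22000 * (\<theta> powr q * 1)) / exp (\<theta> / 2 * s)"
    using mult_left_mono[OF a, of "\<theta> powr q"] by (auto intro!: divide_right_mono)
  finally show ?thesis by (simp add: exp_diff)
qed

text \<open>The exponential moment with \<open>\<theta> = 1 / \<delta>\<close> is bounded by a constant, and \<open>y \<le> exp y\<close> turns it into
  a bound for the first moment that is linear in \<open>\<delta>\<close>.\<close>

lemma blocks_L1:
  assumes q: "1 \<le> q" "q \<le> 2" and d: "\<delta> > 0"
    and blk: "\<And>k. k \<le> K \<Longrightarrow> dyadic_block k (g k)"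
    and bnd: "\<And>k x. k \<le> K \<Longrightarrow> norm (g k x) \<le> a k"
    and a: "(\<Sum>k\<le>K. a k powr q) \<le> \<delta> powr q"
  shows "(LINT x|torus. norm (\<Sum>k\<le>K. g k x)) \<le> \<delta> * (8 * exp 22002)"
proof -
  let ?G = "\<lambda>x. \<Sum>k\<le>K. g k x"
  have G: "continuous_on S ?G" for S
    by (intro continuous_on_sum) (rule continuous_on_dyadic_block[OF blk], simp)
  have "(LINT x|torus. norm (?G x)) \<le> (LINT x|torus. 2 * \<delta> * exp (1 / \<delta> / 2 * norm (?G x)))"
  proof (rule integral_mono)
    show "integrable torus (\<lambda>x. norm (?G x))"
      "integrable torus (\<lambda>x. 2 * \<delta> * exp (1 / \<delta> / 2 * norm (?G x)))"
      by (intro integrable_torus_continuous continuous_intros G)+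
    fix x
    have "1 / \<delta> / 2 * norm (?G x) \<le> exp (1 / \<delta> / 2 * norm (?G x))"
      using exp_ge_add_one_self[of "1 / \<delta> / 2 * norm (?G x)"] by linarith
    from mult_left_mono[OF this, of "2 * \<delta>"]
    show "norm (?G x) \<le> 2 * \<delta> * exp (1 / \<delta> / 2 * norm (?G x))"
      using d by simp
  qed
  also have "\<dots> = 2 * \<delta> * (LINT x|torus. exp (1 / \<delta> / 2 * norm (?G x)))" by simp
  also have "\<dots> \<le> 2 * \<delta> * (4 * exp (2 + 22000 * ((1 / \<delta>) powr q * (\<Sum>k\<le>K. a k powr q))))"
    using d by (intro mult_left_mono exp_norm_integral_blocks[OF q _ blk bnd]) auto
  also have "\<dots> \<le> 2 * \<delta> * (4 * exp (2 + 22000 * 1))"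
  proof -
    have "(1 / \<delta>) powr q * (\<Sum>k\<le>K. a k powr q) \<le> (1 / \<delta>) powr q * \<delta> powr q"
      by (rule mult_left_mono[OF a]) simp
    also have "\<dots> = 1" using d by (simp add: powr_mult[symmetric])
    finally show ?thesis using d by (intro mult_left_mono) auto
  qed
  finally show ?thesis by simp
qed

section \<open>Littlewood-Paley blocks of a distribution\<close>

lemma admissible_cutoffD:
  assumes "admissible_cutoff \<Phi>"
  shows "\<And>s. \<bar>s\<bar> \<le> 1 \<Longrightarrow> \<Phi> s = 1" "\<And>s. \<bar>s\<bar> \<ge> 2 \<Longrightarrow> \<Phi> s = 0"
proof -
  show "\<And>s. \<bar>s\<bar> \<le> 1 \<Longrightarrow> \<Phi> s = 1" using assms by (simp add: admissible_cutoff_def)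
  fix s :: real assume s: "\<bar>s\<bar> \<ge> 2"
  then have "s \<notin> {-2<..<2}" by auto
  moreover have "closure {s. \<Phi> s \<noteq> 0} \<subseteq> {-2<..<2}"
    using assms unfolding admissible_cutoff_def by (elim conjE)
  ultimately have "s \<notin> closure {s. \<Phi> s \<noteq> 0}" by (rule contra_subsetD[rotated])
  then have "s \<notin> {s. \<Phi> s \<noteq> 0}" by (rule contra_subsetD[OF closure_subset])
  then show "\<Phi> s = 0" by simp
qed

lemma LP_multiplier_support:
  assumes "admissible_cutoff \<Phi>" and "LP_multiplier \<Phi> k (of_int n) \<noteq> 0"
  shows "\<bar>n\<bar> \<le> 2 ^ (k + 1)" and "k \<ge> 1 \<Longrightarrow> 2 ^ (k - 1) \<le> \<bar>n\<bar>"
proof -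
  note \<Phi> = admissible_cutoffD[OF assms(1)]
  have conv: "\<bar>real_of_int n\<bar> \<le> 2 ^ m \<longleftrightarrow> \<bar>n\<bar> \<le> 2 ^ m" for m
    by (metis of_int_abs of_int_le_iff of_int_numeral of_int_power)
  show "\<bar>n\<bar> \<le> 2 ^ (k + 1)"
  proof (rule ccontr)
    assume "\<not> \<bar>n\<bar> \<le> 2 ^ (k + 1)"
    then have n: "\<bar>real_of_int n\<bar> > 2 * 2 ^ k" using conv[of "k + 1"] by simp
    show False
    proof (cases k)
      case 0
      then show False using assms(2) n \<Phi>(2)[of "of_int n"] by simp
    next
      case (Suc m)
      have "(0::real) < 2 ^ m" by simp
      then have "\<Phi> (of_int n / 2 ^ Suc m) = 0" "\<Phi> (of_int n / 2 ^ m) = 0"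
        using n Suc by (auto intro!: \<Phi>(2) simp: le_divide_eq)
      then show False using assms(2) Suc by simp
    qed
  qed
  assume "k \<ge> 1"
  then obtain m where m: "k = Suc m" by (cases k) auto
  show "2 ^ (k - 1) \<le> \<bar>n\<bar>"
  proof (rule ccontr)
    assume "\<not> 2 ^ (k - 1) \<le> \<bar>n\<bar>"
    then have n: "\<bar>real_of_int n\<bar> \<le> 2 ^ m" using conv[of m] m by simp
    moreover have "(0::real) < 2 ^ m" by simp
    ultimately have "\<Phi> (of_int n / 2 ^ Suc m) = 1" "\<Phi> (of_int n / 2 ^ m) = 1"
      by (auto intro!: \<Phi>(1) simp: divide_le_eq)
    then show False using assms(2) m by simp
  qed
qed

lemma LP_block_eq_sum:
  assumes "admissible_cutoff \<Phi>"
  shows "LP_block \<Phi> k u x = (\<Sum>n\<in>{n. LP_multiplier \<Phi> k (of_int n) \<noteq> 0}.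
      of_real (LP_multiplier \<Phi> k (of_int n)) * fourier_coeff u n * ee n x)"
    and "finite {n. LP_multiplier \<Phi> k (of_int n) \<noteq> 0}"
proof -
  have "{n. LP_multiplier \<Phi> k (of_int n) \<noteq> 0} \<subseteq> {- (2 ^ (k + 1))..2 ^ (k + 1)}"
    using LP_multiplier_support(1)[OF assms] by fastforce
  then show fin: "finite {n. LP_multiplier \<Phi> k (of_int n) \<noteq> 0}"
    by (rule finite_subset) simp
  have "LP_block \<Phi> k u x = (\<Sum>\<^sub>\<infinity>n\<in>{n. LP_multiplier \<Phi> k (of_int n) \<noteq> 0}.
      of_real (LP_multiplier \<Phi> k (of_int n)) * fourier_coeff u n * ee n x)"
    unfolding LP_block_def exp_eq_ee by (rule infsum_cong_neutral) auto
  then show "LP_block \<Phi> k u x = (\<Sum>n\<in>{n. LP_multiplier \<Phi> k (of_int n) \<noteq> 0}.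
      of_real (LP_multiplier \<Phi> k (of_int n)) * fourier_coeff u n * ee n x)"
    using fin by simp
qed

lemma dyadic_block_LP_block:
  assumes "admissible_cutoff \<Phi>"
  shows "dyadic_block k (LP_block \<Phi> k u)"
  unfolding dyadic_block_def
  by (intro exI[of _ "{n. LP_multiplier \<Phi> k (of_int n) \<noteq> 0}"]
      exI[of _ "\<lambda>n. of_real (LP_multiplier \<Phi> k (of_int n)) * fourier_coeff u n"] conjI ballI ext)
    (use LP_block_eq_sum[OF assms] LP_multiplier_support[OF assms] in auto)

lemma norm_LP_block_le:
  assumes "admissible_cutoff \<Phi>"
  shows "norm (LP_block \<Phi> k u x) \<le> LP_block_norm \<Phi> k u"
  unfolding LP_block_norm_def
proof (rule cSUP_upper)
  have "norm (LP_block \<Phi> k u x) \<le> (\<Sum>n\<in>{n. LP_multiplier \<Phi> k (of_int n) \<noteq> 0}.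
      norm (of_real (LP_multiplier \<Phi> k (of_int n)) * fourier_coeff u n))" for x
    unfolding LP_block_eq_sum[OF assms]
    by (rule sum_norm_le) (simp add: norm_mult)
  then show "bdd_above (range (\<lambda>x. norm (LP_block \<Phi> k u x)))" by (rule bdd_aboveI2)
qed simp

lemma tcoeff_LP_block:
  assumes "admissible_cutoff \<Phi>"
  shows "tcoeff (LP_block \<Phi> k u) n = of_real (LP_multiplier \<Phi> k (of_int n)) * fourier_coeff u n"
proof -
  let ?A = "{n. LP_multiplier \<Phi> k (of_int n) \<noteq> 0}"
  have "tcoeff (LP_block \<Phi> k u) n = (\<Sum>m\<in>?A.
      of_real (LP_multiplier \<Phi> k (of_int m)) * fourier_coeff u m * (if m = n then 1 else 0))"
    unfolding tcoeff_sum[OF LP_block_eq_sum(2)[OF assms], where d = "\<lambda>n. n", symmetric]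
    by (simp add: LP_block_eq_sum(1)[OF assms, abs_def])
  also have "\<dots> = of_real (LP_multiplier \<Phi> k (of_int n)) * fourier_coeff u n"
    using LP_block_eq_sum(2)[OF assms, of k] by (simp add: if_distrib sum.delta cong: if_cong)
  finally show ?thesis .
qed

lemma sum_LP_multiplier: "(\<Sum>k\<le>K. LP_multiplier \<Phi> k s) = \<Phi> (s / 2 ^ K)"
  by (induction K) simp_all

definition LP_partial :: "(real \<Rightarrow> real) \<Rightarrow> nat \<Rightarrow> ((real \<Rightarrow> complex) \<Rightarrow> complex) \<Rightarrow> real \<Rightarrow> complex" where
  "LP_partial \<Phi> K u x = (\<Sum>k\<le>K. LP_block \<Phi> k u x)"

lemma integrable_LP_partial:
  assumes "admissible_cutoff \<Phi>"
  shows "integrable torus (LP_partial \<Phi> K u)"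
  unfolding LP_partial_def
  by (intro integrable_torus_continuous continuous_intros continuous_on_dyadic_block[OF dyadic_block_LP_block[OF assms]])

lemma tcoeff_LP_partial:
  assumes "admissible_cutoff \<Phi>" and "\<bar>n\<bar> \<le> 2 ^ K"
  shows "tcoeff (LP_partial \<Phi> K u) n = fourier_coeff u n"
proof -
  have int: "integrable torus (LP_block \<Phi> k u)" for k
    by (intro integrable_torus_continuous continuous_on_dyadic_block[OF dyadic_block_LP_block[OF assms(1)]])
  have "tcoeff (LP_partial \<Phi> K u) n = (\<Sum>k\<le>K. tcoeff (LP_block \<Phi> k u) n)"
    unfolding tcoeff_def LP_partial_def sum_distrib_right
    by (rule Bochner_Integration.integral_sum) (rule integrable_mult_ee[OF int])
  also have "\<dots> = of_real (\<Sum>k\<le>K. LP_multiplier \<Phi> k (of_int n)) * fourier_coeff u n"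
    by (simp add: tcoeff_LP_block[OF assms(1)] sum_distrib_right)
  also have "(\<Sum>k\<le>K. LP_multiplier \<Phi> k (of_int n)) = 1"
  proof -
    have "\<bar>real_of_int n\<bar> \<le> 2 ^ K"
      using assms(2) by (metis of_int_abs of_int_le_iff of_int_numeral of_int_power)
    then show ?thesis unfolding sum_LP_multiplier
      by (intro admissible_cutoffD[OF assms(1)]) (simp add: divide_le_eq)
  qed
  finally show ?thesis by simp
qed

text \<open>A difference of partial sums is a sum of blocks in which those up to \<open>j\<close> are replaced by zero,
  so its \<open>L\<^sup>1\<close> norm is controlled by a tail of the Besov series.\<close>

lemma LP_partial_Cauchy:
  assumes \<Phi>: "admissible_cutoff \<Phi>" and q: "1 \<le> q" "q \<le> 2"
    and sm: "summable (\<lambda>k. LP_block_norm \<Phi> k u powr q)" and e: "e > 0"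
  shows "\<exists>N. \<forall>i\<ge>N. \<forall>j\<ge>N. (LINT x|torus. norm (LP_partial \<Phi> i u x - LP_partial \<Phi> j u x)) < e"
proof -
  let ?a = "\<lambda>k. LP_block_norm \<Phi> k u"
  define \<delta> where "\<delta> = e / (16 * exp 22002)"
  have d: "\<delta> > 0" using e by (simp add: \<delta>_def)
  have "\<exists>N. \<forall>m\<ge>N. \<forall>n. norm (sum (\<lambda>k. ?a k powr q) {m..<n}) < \<delta> powr q"
    using sm d unfolding summable_Cauchy by simp
  then obtain N where N: "\<And>m n. m \<ge> N \<Longrightarrow> norm (sum (\<lambda>k. ?a k powr q) {m..<n}) < \<delta> powr q"
    by blast
  have lt: "(LINT x|torus. norm (LP_partial \<Phi> i u x - LP_partial \<Phi> j u x)) < e"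
    if "N \<le> j" "j \<le> i" for i j
  proof -
    define g where "g k = (if k \<le> j then (\<lambda>_. 0) else LP_block \<Phi> k u)" for k
    define b where "b k = (if k \<le> j then 0 else ?a k)" for k
    have split: "{..i} = {..j} \<union> {Suc j..<Suc i}" "{..j} \<inter> {Suc j..<Suc i} = {}"
      using that by auto
    have "LP_partial \<Phi> i u x - LP_partial \<Phi> j u x = (\<Sum>k\<le>i. g k x)" for x
      unfolding LP_partial_def split(1) by (subst (1 2) sum.union_disjoint) (auto simp: g_def)
    moreover have "(LINT x|torus. norm (\<Sum>k\<le>i. g k x)) \<le> \<delta> * (8 * exp 22002)"
    proof (rule blocks_L1[OF q d])
      show "dyadic_block k (g k)" for k
        by (simp add: g_def dyadic_block_0 dyadic_block_LP_block[OF \<Phi>])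
      show "norm (g k x) \<le> b k" for k x
        by (simp add: g_def b_def norm_LP_block_le[OF \<Phi>])
      have "(\<Sum>k\<le>i. b k powr q) = (\<Sum>k\<in>{Suc j..<Suc i}. ?a k powr q)"
        unfolding split(1) by (subst sum.union_disjoint) (auto simp: b_def)
      also have "\<dots> \<le> \<delta> powr q"
        using N[of "Suc j" "Suc i"] that by (simp add: abs_le_iff)
      finally show "(\<Sum>k\<le>i. b k powr q) \<le> \<delta> powr q" .
    qed
    moreover have "\<delta> * (8 * exp 22002) < e" using e by (simp add: \<delta>_def)
    ultimately show ?thesis by simp
  qed
  have "(LINT x|torus. norm (LP_partial \<Phi> i u x - LP_partial \<Phi> j u x)) < e" if "i \<ge> N" "j \<ge> N" for i j
    using lt[of j i] lt[of i j] that by (cases "j \<le> i") (auto simp: norm_minus_commute)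
  then show ?thesis by blast
qed

text \<open>A subsequence converges almost everywhere, and Fatou's lemma shows that its pointwise limit is
  also the limit in \<open>L\<^sup>1\<close>.\<close>

lemma L1_Cauchy_limit:
  fixes s :: "nat \<Rightarrow> 'a \<Rightarrow> 'b::{banach, second_countable_topology}"
  assumes int: "\<And>n. integrable M (s n)"
    and cauchy: "\<And>e. e > 0 \<Longrightarrow> \<exists>N. \<forall>i\<ge>N. \<forall>j\<ge>N. LINT x|M. norm (s i x - s j x) < e"
  obtains f r where "integrable M f" "strict_mono r" "(\<lambda>i. LINT x|M. norm (s (r i) x - f x)) \<longlonglongrightarrow> 0"
proof -
  obtain r where r: "strict_mono r" "AE x in M. Cauchy (\<lambda>i. s (r i) x)"
    using cauchy_L1_AE_cauchy_subseq[of M s] assms by blast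
  have [measurable]: "s n \<in> borel_measurable M" for n using int by auto
  define f where "f x = lim (\<lambda>i. s (r i) x)" for x
  have f[measurable]: "f \<in> borel_measurable M" unfolding f_def by measurable
  have lim: "AE x in M. (\<lambda>i. s (r i) x) \<longlonglongrightarrow> f x"
    using r(2) by eventually_elim (auto simp: f_def convergent_LIMSEQ_iff Cauchy_convergent_iff)
  have bound: "\<exists>N. \<forall>i\<ge>N. (\<integral>\<^sup>+x. norm (s (r i) x - f x) \<partial>M) \<le> ennreal e" if e: "e > 0" for e
  proof -
    obtain N where N: "\<And>i j. i \<ge> N \<Longrightarrow> j \<ge> N \<Longrightarrow> (LINT x|M. norm (s i x - s j x)) < e"
      using cauchy[OF e] by blast
    have "(\<integral>\<^sup>+x. norm (s (r i) x - f x) \<partial>M) \<le> ennreal e" if i: "i \<ge> N" for i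
    proof -
      have "(\<integral>\<^sup>+x. norm (s (r i) x - f x) \<partial>M) =
          (\<integral>\<^sup>+x. liminf (\<lambda>j. ennreal (norm (s (r i) x - s (r j) x))) \<partial>M)"
      proof (rule nn_integral_cong_AE)
        show "AE x in M. ennreal (norm (s (r i) x - f x)) = liminf (\<lambda>j. ennreal (norm (s (r i) x - s (r j) x)))"
          using lim
        proof eventually_elim
          case (elim x)
          then have "(\<lambda>j. ennreal (norm (s (r i) x - s (r j) x))) \<longlonglongrightarrow> ennreal (norm (s (r i) x - f x))"
            by (intro tendsto_intros)
          then show ?case by (intro lim_imp_Liminf[symmetric]) auto
        qed
      qed
      also have "\<dots> \<le> liminf (\<lambda>j. \<integral>\<^sup>+x. ennreal (norm (s (r i) x - s (r j) x)) \<partial>M)"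
        by (rule nn_integral_liminf) measurable
      also have "\<dots> \<le> ennreal e"
      proof (rule Liminf_le)
        have "(\<integral>\<^sup>+x. ennreal (norm (s (r i) x - s (r j) x)) \<partial>M) \<le> ennreal e" if "j \<ge> N" for j
        proof -
          have "(\<integral>\<^sup>+x. ennreal (norm (s (r i) x - s (r j) x)) \<partial>M) =
              ennreal (LINT x|M. norm (s (r i) x - s (r j) x))"
            by (rule nn_integral_eq_integral) (auto intro!: integrable_norm Bochner_Integration.integrable_diff int)
          also have "\<dots> \<le> ennreal e"
            using N[of "r i" "r j"] i that seq_suble[OF r(1)] order_trans
            by (intro ennreal_leI less_imp_le) blast
          finally show ?thesis .
        qed
        then show "\<forall>\<^sub>F j in sequentially. (\<integral>\<^sup>+x. ennreal (norm (s (r i) x - s (r j) x)) \<partial>M) \<le> ennreal e"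
          by (auto simp: eventually_sequentially)
      qed simp
      finally show ?thesis .
    qed
    then show ?thesis by blast
  qed
  have fint: "integrable M f"
  proof -
    obtain N where "(\<integral>\<^sup>+x. norm (s (r N) x - f x) \<partial>M) \<le> ennreal 1" using bound[of 1] by auto
    then have "integrable M (\<lambda>x. s (r N) x - f x)"
      by (intro integrableI_bounded) (auto simp: order_le_less_trans)
    from Bochner_Integration.integrable_diff[OF int[of "r N"] this] show ?thesis by simp
  qed
  have "(\<lambda>i. LINT x|M. norm (s (r i) x - f x)) \<longlonglongrightarrow> 0"
  proof (rule LIMSEQ_I)
    fix e :: real assume e: "e > 0"
    obtain N where N: "\<And>i. i \<ge> N \<Longrightarrow> (\<integral>\<^sup>+x. norm (s (r i) x - f x) \<partial>M) \<le> ennreal (e / 2)"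
      using bound[of "e / 2"] e by auto
    have "(LINT x|M. norm (s (r i) x - f x)) \<le> e / 2" if "i \<ge> N" for i
    proof -
      have "ennreal (LINT x|M. norm (s (r i) x - f x)) = (\<integral>\<^sup>+x. norm (s (r i) x - f x) \<partial>M)"
        by (rule nn_integral_eq_integral[symmetric]) (auto intro!: integrable_norm Bochner_Integration.integrable_diff int fint)
      then have "ennreal (LINT x|M. norm (s (r i) x - f x)) \<le> ennreal (e / 2)" using N[OF that] by metis
      then show ?thesis using e by (subst (asm) ennreal_le_iff) auto
    qed
    then show "\<exists>N. \<forall>i\<ge>N. norm ((LINT x|M. norm (s (r i) x - f x)) - 0) < e"
      using e by (intro exI[of _ N]) (force simp: integral_nonneg_AE)
  qed
  then show ?thesis using that fint r(1) by blast
qed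

section \<open>Test functions and their Jackson means\<close>

lemma nth_vector_deriv_0 [simp]: "nth_vector_deriv 0 f = f"
  by (simp add: nth_vector_deriv_def)

lemma nth_vector_deriv_Suc:
  "nth_vector_deriv (Suc n) f = (\<lambda>x. vector_derivative (nth_vector_deriv n f) (at x))"
  by (simp add: nth_vector_deriv_def)

lemma smooth_has_vector_derivative:
  assumes "smooth f"
  shows "(nth_vector_deriv n f has_vector_derivative nth_vector_deriv (Suc n) f x) (at x)"
  using assms unfolding smooth_def nth_vector_deriv_Suc by (simp add: vector_derivative_works)

lemma nth_vector_deriv_SucI:
  assumes "\<And>x. (nth_vector_deriv n f has_vector_derivative g x) (at x)"
  shows "nth_vector_deriv (Suc n) f = g"
  unfolding nth_vector_deriv_Suc using assms by (auto intro: vector_derivative_at)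

lemma smooth_continuous_on:
  assumes "smooth f"
  shows "continuous_on S (nth_vector_deriv n f)"
  using smooth_has_vector_derivative[OF assms] has_vector_derivative_continuous
  by (blast intro: continuous_at_imp_continuous_on)

lemma test_function_periodic:
  assumes "test_function \<psi>"
  shows "periodic1 (nth_vector_deriv n \<psi>)"
proof (induction n)
  case 0
  then show ?case using assms by (simp add: test_function_def)
next
  case (Suc n)
  have sm: "smooth \<psi>" using assms by (simp add: test_function_def)
  show ?case unfolding periodic1_def
  proof
    fix x
    let ?f = "nth_vector_deriv n \<psi>"
    have "((?f \<circ> (\<lambda>x. x + 1)) has_vector_derivative 1 *\<^sub>R nth_vector_deriv (Suc n) \<psi> (x + 1)) (at x)"
      by (rule vector_diff_chain_at)
        (auto intro!: derivative_eq_intros smooth_has_vector_derivative[OF sm])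
    moreover have "?f \<circ> (\<lambda>x. x + 1) = ?f" using Suc by (simp add: periodic1_def o_def)
    ultimately show "nth_vector_deriv (Suc n) \<psi> (x + 1) = nth_vector_deriv (Suc n) \<psi> x"
      using smooth_has_vector_derivative[OF sm, of n x]
      by (auto intro: vector_derivative_unique_at)
  qed
qed

lemma nth_vector_deriv_tsum:
  "nth_vector_deriv m (\<lambda>x. \<Sum>i\<in>I. c i * ee (d i) x) =
     (\<lambda>x. \<Sum>i\<in>I. c i * (2 * of_real pi * \<i> * of_int (d i)) ^ m * ee (d i) x)"
proof (induction m)
  case (Suc m)
  show ?case
  proof (rule nth_vector_deriv_SucI)
    show "(nth_vector_deriv m (\<lambda>x. \<Sum>i\<in>I. c i * ee (d i) x) has_vector_derivative
       (\<Sum>i\<in>I. c i * (2 * of_real pi * \<i> * of_int (d i)) ^ Suc m * ee (d i) x)) (at x)" for x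
      unfolding Suc
      using has_vector_derivative_tsum[of "\<lambda>i. c i * (2 * of_real pi * \<i> * of_int (d i)) ^ m" d I x UNIV]
      by (simp add: mult_ac)
  qed
qed simp

lemma test_function_tsum: "test_function (\<lambda>x. \<Sum>i\<in>I. c i * ee (d i) x)"
  unfolding test_function_def smooth_def nth_vector_deriv_tsum
  by (intro conjI allI periodic1_tsum differentiableI_vector[OF has_vector_derivative_tsum])

lemma test_function_ee: "test_function (ee n)"
  using test_function_tsum[of "\<lambda>_. 1" "\<lambda>i. i" "{n}"] by simp

lemma integrable_test_function:
  assumes "test_function \<psi>"
  shows "integrable torus (nth_vector_deriv n \<psi>)"
  using assms by (auto intro!: integrable_torus_continuous smooth_continuous_on simp: test_function_def)

lemma test_function_bounded:
  assumes "test_function \<psi>"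
  obtains B where "\<And>x. norm (nth_vector_deriv n \<psi> x) \<le> B"
proof -
  have "bounded (nth_vector_deriv n \<psi> ` {0..1})"
    using assms by (intro compact_imp_bounded compact_continuous_image smooth_continuous_on) (auto simp: test_function_def)
  then obtain B where "\<forall>y\<in>nth_vector_deriv n \<psi> ` {0..1}. norm y \<le> B"
    unfolding bounded_iff by blast
  then have B: "\<And>x. x \<in> {0..1} \<Longrightarrow> norm (nth_vector_deriv n \<psi> x) \<le> B" by blast
  have "norm (nth_vector_deriv n \<psi> x) \<le> B" for x
  proof -
    have "x = frac x + of_int \<lfloor>x\<rfloor>" by (simp add: frac_def)
    then have "nth_vector_deriv n \<psi> x = nth_vector_deriv n \<psi> (frac x)"
      using periodic1_add_int[OF test_function_periodic[OF assms]] by metis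
    then show ?thesis using B[of "frac x"] frac_ge_0[of x] frac_lt_1[of x] by simp
  qed
  then show ?thesis using that by blast
qed

text \<open>Integration by parts; the boundary terms cancel by periodicity.\<close>

lemma tcoeff_deriv:
  assumes per: "periodic1 f" and der: "\<And>x. (f has_vector_derivative f' x) (at x)"
    and cont: "continuous_on {0..1} f'"
  shows "tcoeff f' n = 2 * of_real pi * \<i> * of_int n * tcoeff f n"
proof -
  have cf: "continuous_on {0..1} f"
    using der has_vector_derivative_continuous by (blast intro: continuous_at_imp_continuous_on)
  have T: "tcoeff h n = integral {0..1} (\<lambda>x. h x * ee (- n) x)" if "continuous_on {0..1} h" for h
    unfolding tcoeff_def by (intro integrable_torus_continuous continuous_intros that)
  have int: "(\<lambda>x. f' x * ee (- n) x) integrable_on {0..1}"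
    "(\<lambda>x. 2 * of_real pi * \<i> * of_int n * (f x * ee (- n) x)) integrable_on {0..1}"
    by (intro integrable_continuous_real continuous_intros cf cont)+
  have "((\<lambda>x. f' x * ee (- n) x - 2 * of_real pi * \<i> * of_int n * (f x * ee (- n) x)) has_integral
      (f 1 * ee (- n) 1 - f 0 * ee (- n) 0)) {0..1}"
  proof (rule fundamental_theorem_of_calculus)
    fix x
    have "((\<lambda>x. f x * ee (- n) x) has_vector_derivative
       (f x * (2 * of_real pi * \<i> * of_int (- n) * ee (- n) x) + f' x * ee (- n) x)) (at x within {0..1})"
      by (intro has_vector_derivative_mult has_vector_derivative_at_within[OF der] has_vector_derivative_ee)
    then show "((\<lambda>x. f x * ee (- n) x) has_vector_derivative
        f' x * ee (- n) x - 2 * of_real pi * \<i> * of_int n * (f x * ee (- n) x)) (at x within {0..1})"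
      by (simp add: algebra_simps)
  qed simp
  moreover have "f 1 * ee (- n) 1 - f 0 * ee (- n) 0 = 0"
    using periodic1_add_int[OF per, of 0 1] ee_int[of "- n" 1] by simp
  ultimately have "integral {0..1} (\<lambda>x. f' x * ee (- n) x - 2 * of_real pi * \<i> * of_int n * (f x * ee (- n) x)) = 0"
    by (simp add: integral_unique)
  then show ?thesis
    unfolding T[OF cf] T[OF cont] by (subst (asm) integral_diff[OF int]) simp
qed

text \<open>The mean multiplies Fourier coefficients, and so does differentiation.\<close>

lemma nth_vector_deriv_jackson_mean:
  assumes "test_function \<psi>"
  shows "nth_vector_deriv m (jackson_mean N \<psi>) = jackson_mean N (nth_vector_deriv m \<psi>)"
proof (induction m)
  case (Suc m)
  have sm: "smooth \<psi>" using assms by (simp add: test_function_def)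
  have tc: "tcoeff (nth_vector_deriv (Suc m) \<psi>) n = 2 * of_real pi * \<i> * of_int n * tcoeff (nth_vector_deriv m \<psi>) n" for n
    by (rule tcoeff_deriv[OF test_function_periodic[OF assms] smooth_has_vector_derivative[OF sm] smooth_continuous_on[OF sm]])
  show ?case
  proof (rule nth_vector_deriv_SucI)
    fix x
    have "(jackson_mean N (nth_vector_deriv m \<psi>) has_vector_derivative
        (\<Sum>p\<in>{1..N}\<times>{1..N}. (of_real (jweight N (fst p) * jweight N (snd p) / jmass N) *
          tcoeff (nth_vector_deriv m \<psi>) (int (fst p) - int (snd p))) *
          (2 * of_real pi * \<i> * of_int (int (fst p) - int (snd p))) * ee (int (fst p) - int (snd p)) x)) (at x)"
      unfolding jackson_mean_tsum[of N "nth_vector_deriv m \<psi>"] by (rule has_vector_derivative_tsum)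
    also have "(\<Sum>p\<in>{1..N}\<times>{1..N}. (of_real (jweight N (fst p) * jweight N (snd p) / jmass N) *
          tcoeff (nth_vector_deriv m \<psi>) (int (fst p) - int (snd p))) *
          (2 * of_real pi * \<i> * of_int (int (fst p) - int (snd p))) * ee (int (fst p) - int (snd p)) x)
        = jackson_mean N (nth_vector_deriv (Suc m) \<psi>) x"
      unfolding jackson_mean_def tc by (simp add: mult_ac)
    finally show "(nth_vector_deriv m (jackson_mean N \<psi>) has_vector_derivative
        jackson_mean N (nth_vector_deriv (Suc m) \<psi>) x) (at x)" unfolding Suc .
  qed
qed simp

lemma nth_vector_deriv_minus:
  assumes "smooth f" "smooth g"
  shows "nth_vector_deriv n (\<lambda>x. f x - g x) = (\<lambda>x. nth_vector_deriv n f x - nth_vector_deriv n g x)"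
proof (induction n)
  case (Suc n)
  show ?case
    by (rule nth_vector_deriv_SucI)
      (auto simp: Suc intro!: has_vector_derivative_diff smooth_has_vector_derivative assms)
qed simp

lemma test_function_minus:
  assumes "test_function f" "test_function g"
  shows "test_function (\<lambda>x. f x - g x)"
proof -
  have sm: "smooth f" "smooth g" using assms by (auto simp: test_function_def)
  have "smooth (\<lambda>x. f x - g x)"
    unfolding smooth_def nth_vector_deriv_minus[OF sm]
    using sm by (auto intro!: differentiable_diff simp: smooth_def)
  then show ?thesis using assms by (auto simp: test_function_def periodic1_def)
qed

section \<open>Distributions are determined by their Fourier coefficients\<close>

lemma periodic_distribution_add:
  "periodic_distribution u \<Longrightarrow> test_function \<psi> \<Longrightarrow> test_function \<eta> \<Longrightarrow> u (\<lambda>x. \<psi> x + \<eta> x) = u \<psi> + u \<eta>"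
  and periodic_distribution_mult:
  "periodic_distribution u \<Longrightarrow> test_function \<psi> \<Longrightarrow> u (\<lambda>x. a * \<psi> x) = a * u \<psi>"
  by (simp_all add: periodic_distribution_def)

lemma periodic_distribution_minus:
  assumes "periodic_distribution u" "test_function \<psi>" "test_function \<eta>"
  shows "u (\<lambda>x. \<psi> x - \<eta> x) = u \<psi> - u \<eta>"
  using periodic_distribution_add[OF assms(1) test_function_minus[OF assms(2,3)] assms(3)] by simp

lemma periodic_distribution_tsum:
  assumes u: "periodic_distribution u" and "finite I"
  shows "u (\<lambda>x. \<Sum>i\<in>I. c i * ee (d i) x) = (\<Sum>i\<in>I. c i * u (ee (d i)))"
  using assms(2)
proof (induction I)
  case empty
  show ?case using periodic_distribution_mult[OF u test_function_ee[of 0], of 0] by simp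
next
  case (insert i I)
  have "test_function (\<lambda>x. c i * ee (d i) x)"
    using test_function_tsum[of c d "{i}"] by simp
  from periodic_distribution_add[OF u this test_function_tsum[of c d I]] insert
  show ?case by (simp add: periodic_distribution_mult[OF u test_function_ee])
qed

lemma fourier_coeff_ee: "fourier_coeff u n = u (ee (- n))"
  unfolding fourier_coeff_def exp_eq_ee ..

lemma integrable_mult_bounded:
  fixes f \<psi> :: "real \<Rightarrow> complex"
  assumes f: "integrable torus f" and "\<psi> \<in> borel_measurable torus" and bnd: "\<And>x. norm (\<psi> x) \<le> B"
  shows "integrable torus (\<lambda>x. f x * \<psi> x)"
    and "norm (LINT x|torus. f x * \<psi> x) \<le> (LINT x|torus. norm (f x)) * B"
proof -
  have le: "norm (f x * \<psi> x) \<le> norm (f x) * B" for x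
    using bnd[of x] by (simp add: norm_mult mult_left_mono)
  have i: "integrable torus (\<lambda>x. norm (f x) * B)" using f by (intro integrable_mult_left integrable_norm)
  show *: "integrable torus (\<lambda>x. f x * \<psi> x)"
  proof (rule Bochner_Integration.integrable_bound[OF i])
    show "(\<lambda>x. f x * \<psi> x) \<in> borel_measurable torus"
      using f assms(2) by (intro borel_measurable_times) auto
    show "AE x in torus. norm (f x * \<psi> x) \<le> norm (norm (f x) * B)"
      using le by (intro AE_I2) (smt (verit) real_norm_def)
  qed
  have "norm (LINT x|torus. f x * \<psi> x) \<le> (LINT x|torus. norm (f x * \<psi> x))" by (rule integral_norm_bound)
  also have "\<dots> \<le> (LINT x|torus. norm (f x) * B)"
    by (rule integral_mono[OF integrable_norm[OF *] i le])
  finally show "norm (LINT x|torus. f x * \<psi> x) \<le> (LINT x|torus. norm (f x)) * B" by simp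
qed

lemma test_function_measurable: "test_function \<psi> \<Longrightarrow> \<psi> \<in> borel_measurable torus"
  using integrable_test_function[of \<psi> 0] by auto

text \<open>Jackson means of a test function are trigonometric sums converging to it in all derivatives,
  so both sides are continuous along them.\<close>

lemma distribution_eq_integral:
  assumes u: "periodic_distribution u" and f: "integrable torus f"
    and ee: "\<And>n. u (ee n) = (LINT x|torus. f x * ee n x)" and \<psi>: "test_function \<psi>"
  shows "u \<psi> = (LINT x|torus. f x * \<psi> x)"
proof -
  have sm: "smooth \<psi>" and per: "periodic1 \<psi>" using \<psi> by (auto simp: test_function_def)
  obtain C M where C: "\<And>\<psi>. test_function \<psi> \<Longrightarrow>
      norm (u \<psi>) \<le> C * (\<Sum>j\<le>M. SUP x. norm (nth_vector_deriv j \<psi> x))"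
    using u unfolding periodic_distribution_def by blast
  have "\<exists>B. \<forall>j x. norm (nth_vector_deriv j \<psi> x) \<le> B j"
    by (intro choice allI) (metis test_function_bounded[OF \<psi>])
  then obtain B where B: "\<And>j x. norm (nth_vector_deriv j \<psi> x) \<le> B j" by blast
  let ?P = "\<lambda>N. jackson_mean N \<psi>"
  have tP: "test_function (?P N)" for N unfolding jackson_mean_tsum by (rule test_function_tsum)
  then have smP: "smooth (?P N)" for N by (auto simp: test_function_def)
  have uP: "u (?P N) = (LINT x|torus. f x * ?P N x)" for N
    unfolding integral_mult_jackson_mean[OF f] ee[symmetric]
    unfolding jackson_mean_tsum
    by (rule periodic_distribution_tsum[OF u]) simp
  have approx: "norm (nth_vector_deriv j (\<lambda>x. ?P N x - \<psi> x) x) \<le> B (Suc j) / real N" if "N \<ge> 1" for N j x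
    unfolding nth_vector_deriv_minus[OF smP sm] nth_vector_deriv_jackson_mean[OF \<psi>]
    by (rule jackson_mean_approx[OF that test_function_periodic[OF \<psi>] smooth_has_vector_derivative[OF sm] B])
  have bound: "norm (u \<psi> - (LINT x|torus. f x * \<psi> x)) \<le>
      (\<bar>C\<bar> * (\<Sum>j\<le>M. B (Suc j)) + (LINT x|torus. norm (f x)) * B 1) / real N" if N: "N \<ge> 1" for N
  proof -
    have nn: "0 \<le> (SUP x. norm (nth_vector_deriv j (\<lambda>x. ?P N x - \<psi> x) x))" for j
    proof -
      have "norm (nth_vector_deriv j (\<lambda>x. ?P N x - \<psi> x) 0) \<le> (SUP x. norm (nth_vector_deriv j (\<lambda>x. ?P N x - \<psi> x) x))"
        by (rule cSUP_upper) (use approx[OF N] in \<open>auto intro!: bdd_aboveI2\<close>)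
      then show ?thesis using norm_ge_zero order_trans by blast
    qed
    have "norm (u (?P N) - u \<psi>) \<le> C * (\<Sum>j\<le>M. SUP x. norm (nth_vector_deriv j (\<lambda>x. ?P N x - \<psi> x) x))"
      unfolding periodic_distribution_minus[OF u tP \<psi>, symmetric]
      by (rule C[OF test_function_minus[OF tP \<psi>]])
    also have "\<dots> \<le> \<bar>C\<bar> * (\<Sum>j\<le>M. SUP x. norm (nth_vector_deriv j (\<lambda>x. ?P N x - \<psi> x) x))"
      by (rule mult_right_mono) (auto intro!: sum_nonneg nn)
    also have "\<dots> \<le> \<bar>C\<bar> * (\<Sum>j\<le>M. B (Suc j) / real N)"
      by (intro mult_left_mono sum_mono cSUP_least approx N) auto
    finally have 1: "norm (u (?P N) - u \<psi>) \<le> \<bar>C\<bar> * (\<Sum>j\<le>M. B (Suc j)) / real N"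
      by (simp only: sum_divide_distrib[symmetric] times_divide_eq_right)
    have m: "(\<lambda>x. ?P N x - \<psi> x) \<in> borel_measurable torus"
      by (intro test_function_measurable test_function_minus tP \<psi>)
    have b: "norm (?P N x - \<psi> x) \<le> B 1 / real N" for x using approx[OF N, of 0 x] by simp
    obtain B' where "\<And>x. norm (?P N x) \<le> B'"
      using test_function_bounded[OF tP[of N], of 0] by auto
    then have "integrable torus (\<lambda>x. f x * ?P N x)"
      by (rule integrable_mult_bounded(1)[OF f test_function_measurable[OF tP]])
    moreover have "integrable torus (\<lambda>x. f x * \<psi> x)"
      by (rule integrable_mult_bounded(1)[OF f test_function_measurable[OF \<psi>] B[of 0, simplified]])
    ultimately have "(LINT x|torus. f x * ?P N x) - (LINT x|torus. f x * \<psi> x) = (LINT x|torus. f x * (?P N x - \<psi> x))"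
      by (simp add: right_diff_distrib)
    then have 2: "norm ((LINT x|torus. f x * ?P N x) - (LINT x|torus. f x * \<psi> x)) \<le> (LINT x|torus. norm (f x)) * (B 1 / real N)"
      using integrable_mult_bounded(2)[OF f m b] by simp
    have "u \<psi> - (LINT x|torus. f x * \<psi> x) =
        ((LINT x|torus. f x * ?P N x) - (LINT x|torus. f x * \<psi> x)) - (u (?P N) - u \<psi>)"
      using uP[of N] by simp
    then have "norm (u \<psi> - (LINT x|torus. f x * \<psi> x)) \<le>
        norm ((LINT x|torus. f x * ?P N x) - (LINT x|torus. f x * \<psi> x)) + norm (u (?P N) - u \<psi>)"
      using norm_triangle_ineq4 by metis
    then show ?thesis using 1 2 by (simp add: add_divide_distrib)
  qed
  have "(\<lambda>N. (\<bar>C\<bar> * (\<Sum>j\<le>M. B (Suc j)) + (LINT x|torus. norm (f x)) * B 1) / real N) \<longlonglongrightarrow> 0"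
    by (rule lim_const_over_n)
  then have "norm (u \<psi> - (LINT x|torus. f x * \<psi> x)) \<le> 0"
    by (rule LIMSEQ_le_const) (use bound in blast)
  then show ?thesis by simp
qed

section \<open>The upper bound\<close>

text \<open>The Fourier coefficient at \<open>n\<close> of the partial sums is that of \<open>u\<close> as soon as
  \<open>2 ^ r i \<ge> \<bar>n\<bar>\<close>, and it passes to the limit in \<open>L\<^sup>1\<close>.\<close>

lemma besov_representative:
  assumes \<Phi>: "admissible_cutoff \<Phi>" and q: "1 \<le> q" "q \<le> 2" and u: "u \<in> besov_space \<Phi> q"
  obtains f r where "represents f u" "strict_mono r"
    "(\<lambda>i. LINT x|torus. norm (LP_partial \<Phi> (r i) u x - f x)) \<longlonglongrightarrow> 0"
proof -
  have pd: "periodic_distribution u" and sm: "summable (\<lambda>k. LP_block_norm \<Phi> k u powr q)"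
    using u by (auto simp: besov_space_def)
  obtain f r where f: "integrable torus f" and r: "strict_mono r"
    and lim: "(\<lambda>i. LINT x|torus. norm (LP_partial \<Phi> (r i) u x - f x)) \<longlonglongrightarrow> 0"
    using L1_Cauchy_limit[OF integrable_LP_partial[OF \<Phi>] LP_partial_Cauchy[OF \<Phi> q sm]] by blast
  have coeff: "u (ee n) = (LINT x|torus. f x * ee n x)" for n
  proof -
    let ?S = "\<lambda>i. LP_partial \<Phi> (r i) u"
    have conv: "(\<lambda>i. LINT x|torus. ?S i x * ee n x) \<longlonglongrightarrow> (LINT x|torus. f x * ee n x)"
    proof (rule LIM_zero_cancel, rule Lim_null_comparison[OF _ lim], rule always_eventually, rule allI)
      fix i
      have iS: "integrable torus (?S i)" by (rule integrable_LP_partial[OF \<Phi>])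
      have "(LINT x|torus. ?S i x * ee n x) - (LINT x|torus. f x * ee n x) = (LINT x|torus. (?S i x - f x) * ee n x)"
        by (simp add: integrable_mult_ee[OF iS] integrable_mult_ee[OF f] left_diff_distrib)
      also have "norm \<dots> \<le> (LINT x|torus. norm (?S i x - f x)) * 1"
        by (rule integrable_mult_bounded(2))
          (auto intro!: Bochner_Integration.integrable_diff iS f borel_measurable_integrable)
      finally show "norm ((LINT x|torus. ?S i x * ee n x) - (LINT x|torus. f x * ee n x)) \<le>
          (LINT x|torus. norm (?S i x - f x))" by simp
    qed
    obtain K :: nat where K: "real_of_int \<bar>n\<bar> < 2 ^ K" using real_arch_pow[of 2] by auto
    have "(LINT x|torus. ?S i x * ee n x) = u (ee n)" if "i \<ge> K" for i
    proof -
      have "(2::real) ^ K \<le> 2 ^ r i"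
        using that seq_suble[OF r, of i] by (intro power_increasing) auto
      then have "real_of_int \<bar>n\<bar> \<le> 2 ^ r i" using K by linarith
      then have "real_of_int \<bar>n\<bar> \<le> of_int (2 ^ r i)" by simp
      then have "\<bar>- n\<bar> \<le> 2 ^ r i" unfolding of_int_le_iff by simp
      from tcoeff_LP_partial[OF \<Phi> this, of u] show ?thesis
        by (simp add: tcoeff_def fourier_coeff_ee)
    qed
    then have "(\<lambda>i. LINT x|torus. ?S i x * ee n x) \<longlonglongrightarrow> u (ee n)"
      by (intro tendsto_eventually) (auto simp: eventually_sequentially)
    then show ?thesis using conv LIMSEQ_unique by blast
  qed
  \<comment> \<open>The limit is only determined on the fundamental domain; extend it periodically.\<close>
  define f' where "f' x = f (frac x)" for x
  have eq: "f' x = f x" if "x \<in> {0..<1}" for x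
    using that frac_eq[of x] by (auto simp: f'_def)
  have "represents f' u" unfolding represents_def set_integral_torus
  proof (intro conjI allI impI)
    show "periodic1 f'" by (simp add: periodic1_def f'_def frac_def)
    have "integrable torus f' = integrable torus f"
      by (rule Bochner_Integration.integrable_cong) (auto simp: eq)
    then show "integrable torus f'" using f by simp
    fix \<psi> :: "real \<Rightarrow> complex" assume "test_function \<psi>"
    then have "u \<psi> = (LINT x|torus. f x * \<psi> x)"
      by (rule distribution_eq_integral[OF pd f coeff])
    also have "\<dots> = (LINT x|torus. f' x * \<psi> x)"
      by (rule Bochner_Integration.integral_cong) (auto simp: eq)
    finally show "u \<psi> = (LINT x|torus. f' x * \<psi> x)" .
  qed
  moreover have "(LINT x|torus. norm (LP_partial \<Phi> (r i) u x - f x)) =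
      (LINT x|torus. norm (LP_partial \<Phi> (r i) u x - f' x))" for i
    by (rule Bochner_Integration.integral_cong) (auto simp: eq)
  ultimately show ?thesis using that r lim by simp
qed

text \<open>The tail estimate for the partial sums passes to the limit: where \<open>\<bar>f\<bar> > s\<close>, either the partial
  sum exceeds \<open>s / 2\<close> or it differs from \<open>f\<close> by at least \<open>s / 2\<close>, and the measure of the second
  event tends to zero by Markov's inequality.\<close>

lemma besov_tail:
  assumes \<Phi>: "admissible_cutoff \<Phi>" and q: "1 \<le> q" "q \<le> 2"
    and u: "u \<in> besov_space \<Phi> q" "besov_norm \<Phi> q u \<le> 1"
  obtains f where "represents f u"
    "\<And>\<theta> s. \<theta> > 0 \<Longrightarrow> s > 0 \<Longrightarrow> measure torus {x \<in> {0..<1}. norm (f x) > s} \<le>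
      4 * exp (2 + 22000 * \<theta> powr q - \<theta> / 4 * s)"
proof -
  obtain f r where f: "represents f u" and r: "strict_mono r"
    and lim: "(\<lambda>i. LINT x|torus. norm (LP_partial \<Phi> (r i) u x - f x)) \<longlonglongrightarrow> 0"
    using besov_representative[OF \<Phi> q u(1)] by blast
  have fint: "integrable torus f" using f by (simp add: represents_def set_integral_torus)
  have sm: "summable (\<lambda>k. LP_block_norm \<Phi> k u powr q)" using u by (auto simp: besov_space_def)
  have "(\<Sum>k. LP_block_norm \<Phi> k u powr q) \<le> 1"
  proof (rule ccontr)
    assume "\<not> ?thesis"
    then have "1 < (\<Sum>k. LP_block_norm \<Phi> k u powr q) powr (1 / q)"
      using q by (intro gr_one_powr) auto
    then show False using u(2) by (simp add: besov_norm_def)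
  qed
  then have le1: "(\<Sum>k\<le>K. LP_block_norm \<Phi> k u powr q) \<le> 1" for K
    using sum_le_suminf[OF sm, of "{..K}"] by simp
  interpret finite_measure torus by (rule finite_measure_torus)
  have "measure torus {x \<in> {0..<1}. norm (f x) > s} \<le> 4 * exp (2 + 22000 * \<theta> powr q - \<theta> / 4 * s)"
    if \<theta>: "\<theta> > 0" and s: "s > 0" for \<theta> s
  proof -
    let ?E = "4 * exp (2 + 22000 * \<theta> powr q - \<theta> / 4 * s)"
    let ?S = "\<lambda>i. LP_partial \<Phi> (r i) u"
    let ?D = "\<lambda>i. LINT x|torus. norm (?S i x - f x)"
    have "measure torus {x \<in> {0..<1}. norm (f x) > s} \<le> ?E + ?D i / (s / 2)" for i
    proof -
      have iS: "integrable torus (?S i)" by (rule integrable_LP_partial[OF \<Phi>])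
      have iD: "integrable torus (\<lambda>x. norm (?S i x - f x))"
        by (intro integrable_norm Bochner_Integration.integrable_diff iS fint)
      note [measurable] = borel_measurable_integrable[OF iS] borel_measurable_integrable[OF fint]
      have sp: "{x \<in> {0..<1}. P x} = {x \<in> space torus. P x}" for P by simp
      have m: "{x \<in> {0..<1}. norm (?S i x) > s / 2} \<in> sets torus"
        "{x \<in> space torus. norm (?S i x - f x) \<ge> s / 2} \<in> sets torus"
        unfolding sp by measurable
      have "norm (f x) \<le> norm (?S i x) + norm (?S i x - f x)" for x
        using norm_triangle_sub[of "f x" "?S i x"] by (simp add: norm_minus_commute)
      then have "{x \<in> {0..<1}. norm (f x) > s} \<subseteq> {x \<in> {0..<1}. norm (?S i x) > s / 2} \<union>
          {x \<in> space torus. norm (?S i x - f x) \<ge> s / 2}"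
        by (auto simp: not_less not_le) (smt (verit) field_sum_of_halves)
      then have "measure torus {x \<in> {0..<1}. norm (f x) > s} \<le>
          measure torus ({x \<in> {0..<1}. norm (?S i x) > s / 2} \<union> {x \<in> space torus. norm (?S i x - f x) \<ge> s / 2})"
        using m by (intro finite_measure_mono) auto
      also have "\<dots> \<le> measure torus {x \<in> {0..<1}. norm (?S i x) > s / 2} +
          measure torus {x \<in> space torus. norm (?S i x - f x) \<ge> s / 2}"
        by (rule measure_Un_le[OF m])
      also have "measure torus {x \<in> {0..<1}. norm (?S i x) > s / 2} \<le>
          4 * exp (2 + 22000 * \<theta> powr q - \<theta> / 2 * (s / 2))"
        unfolding LP_partial_def
        by (rule blocks_tail[OF q \<theta> dyadic_block_LP_block[OF \<Phi>] norm_LP_block_le[OF \<Phi>] le1])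
      also have "measure torus {x \<in> space torus. norm (?S i x - f x) \<ge> s / 2} \<le> ?D i / (s / 2)"
        using integral_Markov_inequality_measure[OF iD, of "space torus" "s / 2"] s by simp
      finally show ?thesis by simp
    qed
    moreover have "(\<lambda>i. ?E + ?D i / (s / 2)) \<longlonglongrightarrow> ?E + 0 / (s / 2)"
      using s by (intro tendsto_intros lim) auto
    ultimately have "measure torus {x \<in> {0..<1}. norm (f x) > s} \<le> ?E + 0 / (s / 2)"
      by (intro LIMSEQ_le_const) blast+
    then show ?thesis by simp
  qed
  then show ?thesis using that f by blast
qed

lemma four_le_exp_2: "4 \<le> exp (2::real)"
proof -
  have "2 * 2 \<le> exp 1 * exp (1::real)"
    using exp_ge_add_one_self[of 1] by (intro mult_mono) auto
  then show ?thesis by (simp flip: exp_add)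
qed

lemma half_le_ln_2: "1 / 2 \<le> ln (2::real)"
  using ln_one_minus_pos_lower_bound[of "1/2::real"] ln_le_minus_one[of "1/2::real"]
  by (simp add: ln_div)

lemma growth_envelope_le:
  assumes \<Phi>: "admissible_cutoff \<Phi>" and q: "1 \<le> q" "q \<le> 2" and t: "0 < t" "t \<le> 1 / 2"
  shows "growth_envelope \<Phi> q t \<le> ennreal (88036 * \<bar>ln t\<bar> powr (1 - 1 / q))"
  unfolding growth_envelope_def
proof (rule SUP_least)
  define L where "L = \<bar>ln t\<bar>"
  have lnt: "ln t = - L" and L: "L \<ge> 1 / 2"
  proof -
    have "ln t \<le> ln (1 / 2)" using t by (subst ln_le_cancel_iff) auto
    then have "ln t \<le> - (1 / 2)" using half_le_ln_2 by (simp add: ln_div)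
    then show "ln t = - L" "L \<ge> 1 / 2" by (auto simp: L_def)
  qed
  \<comment> \<open>This choice balances the two terms: \<open>\<theta> powr q = L\<close> and \<open>\<theta> / 4 * s = 22009 * L\<close>.  The surplus
     \<open>9 * L\<close> over \<open>22000 * L\<close> absorbs the factor \<open>4 * exp 2 \<le> exp 4 \<le> exp (8 * L)\<close> and still
     leaves \<open>exp (- L) = t\<close>.\<close>
  define s where "s = 88036 * L powr (1 - 1 / q)"
  define \<theta> where "\<theta> = L powr (1 / q)"
  have pos: "s > 0" "\<theta> > 0" using L by (auto simp: s_def \<theta>_def)
  fix u assume "u \<in> {u \<in> besov_space \<Phi> q. besov_norm \<Phi> q u \<le> 1}"
  then obtain f where f: "represents f u"
    and tail: "\<And>\<theta> s. \<theta> > 0 \<Longrightarrow> s > 0 \<Longrightarrow> measure torus {x \<in> {0..<1}. norm (f x) > s} \<le>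
      4 * exp (2 + 22000 * \<theta> powr q - \<theta> / 4 * s)"
    using besov_tail[OF \<Phi> q] by blast
  have "measure torus {x \<in> {0..<1}. norm (f x) > s} \<le> 4 * exp (2 + 22000 * \<theta> powr q - \<theta> / 4 * s)"
    by (rule tail[OF pos(2) pos(1)])
  also have "\<theta> powr q = L" using q L by (simp add: \<theta>_def powr_powr)
  also have "\<theta> / 4 * s = 22009 * L"
    using L by (simp add: \<theta>_def s_def powr_add[symmetric])
  also have "4 * exp (2 + 22000 * L - 22009 * L) \<le> exp 2 * exp (2 + 22000 * L - 22009 * L)"
    using four_le_exp_2 by (intro mult_right_mono) auto
  also have "\<dots> \<le> exp (- L)" using L by (simp flip: exp_add)
  also have "\<dots> = t" using t lnt by (metis exp_ln)
  finally have le: "measure torus {x \<in> {0..<1}. norm (f x) > s} \<le> t" .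
  have "emeasure lebesgue {x \<in> {0..<1}. norm (f x) > s} = emeasure torus {x \<in> {0..<1}. norm (f x) > s}"
    by (rule emeasure_restrict_space[symmetric]) auto
  also have "\<dots> = ennreal (measure torus {x \<in> {0..<1}. norm (f x) > s})"
    using finite_measure.emeasure_eq_measure[OF finite_measure_torus] .
  also have "\<dots> \<le> ennreal t" by (rule ennreal_leI[OF le])
  finally have "decr_rearrangement f t \<le> ennreal s"
    unfolding decr_rearrangement_def using pos by (intro INF_lower) auto
  moreover have "distr_rearrangement u t \<le> decr_rearrangement f t"
    unfolding distr_rearrangement_def using f by (intro INF_lower) auto
  ultimately show "distr_rearrangement u t \<le> ennreal (88036 * \<bar>ln t\<bar> powr (1 - 1 / q))"
    by (simp add: s_def L_def)
qed

section \<open>Integrable functions are determined by their Fourier coefficients\<close>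

lemma two_dist_int_le_abs_sin_pi:
  fixes y \<eta> :: real
  assumes "0 \<le> \<eta>" "\<eta> \<le> \<bar>y\<bar>" "\<bar>y\<bar> \<le> 1 - \<eta>"
  shows "2 * \<eta> \<le> \<bar>sin (pi * y)\<bar>"
proof (cases "\<bar>y\<bar> \<le> 1 / 2")
  case True
  then show ?thesis using two_abs_le_abs_sin_pi[OF True] assms by linarith
next
  case False
  have "\<bar>sin (pi * y)\<bar> = \<bar>sin (pi * \<bar>y\<bar>)\<bar>" by (simp add: abs_if)
  also have "\<dots> = \<bar>sin (pi * (1 - \<bar>y\<bar>))\<bar>" by (simp add: right_diff_distrib)
  finally have "\<bar>sin (pi * y)\<bar> = \<bar>sin (pi * (1 - \<bar>y\<bar>))\<bar>" .
  moreover have "2 * \<bar>1 - \<bar>y\<bar>\<bar> \<le> \<bar>sin (pi * (1 - \<bar>y\<bar>))\<bar>"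
    by (rule two_abs_le_abs_sin_pi) (use False assms in linarith)
  moreover have "\<eta> \<le> \<bar>1 - \<bar>y\<bar>\<bar>"
    by (rule order_trans[OF _ abs_ge_self]) (use assms(3) in simp)
  ultimately show ?thesis by simp
qed

text \<open>The Jackson means of the indicator are trigonometric sums, hence orthogonal to \<open>h\<close>.  They are
  bounded by \<open>2\<close> and converge to the indicator away from \<open>0\<close> and \<open>b\<close>: points on the other side
  of a jump have positive distance from \<open>x\<close> on the circle, so \<open>sin\<^sup>2\<close> is bounded below there.\<close>

lemma integral_initial_interval:
  assumes h: "integrable torus h" and zero: "\<And>n. (LINT x|torus. h x * ee n x) = 0"
    and b: "0 < b" "b < 1"
  shows "(LINT x|torus. h x * indicator {..<b} x) = 0"
proof -
  let ?\<chi> = "\<lambda>x. indicator {..<b} x :: complex"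
  let ?P = "\<lambda>N. jackson_mean (Suc N) ?\<chi>"
  have m\<chi>: "?\<chi> \<in> borel_measurable torus"
    by (intro measurable_restrict_space1 measurable_completion) measurable
  have \<chi>: "integrable torus ?\<chi>"
    by (rule finite_measure.integrable_const_bound[OF finite_measure_torus _ m\<chi>, of 1]) (auto simp: indicator_def)
  have zP: "(LINT x|torus. h x * ?P N x) = 0" for N
    unfolding integral_mult_jackson_mean[OF h] zero by simp
  have "(\<lambda>N. LINT x|torus. h x * ?P N x) \<longlonglongrightarrow> (LINT x|torus. h x * ?\<chi> x)"
  proof (rule integral_dominated_convergence[where w = "\<lambda>x. norm (h x) * 2"])
    show "(\<lambda>x. h x * ?\<chi> x) \<in> borel_measurable torus"
      using h m\<chi> by (intro borel_measurable_times) auto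
    have mP: "?P N \<in> borel_measurable torus" for N
      unfolding jackson_mean_tsum by (rule borel_measurable_integrable[OF integrable_tsum])
    show "(\<lambda>x. h x * ?P N x) \<in> borel_measurable torus" for N
      using h mP by (intro borel_measurable_times) auto
    show "integrable torus (\<lambda>x. norm (h x) * 2)" using h by simp
    show "AE x in torus. norm (h x * ?P N x) \<le> norm (h x) * 2" for N
    proof (rule AE_I2)
      fix x
      have "norm (?P N x - ?\<chi> x) \<le> (LINT s|torus. jackson (Suc N) (x - s) * 1)"
        by (rule norm_jackson_mean_minus[OF _ \<chi>])
          (auto intro!: integrable_torus_continuous continuous_intros simp: indicator_def)
      then have "norm (?P N x - ?\<chi> x) \<le> 1" by (simp add: integral_jackson)
      moreover have "norm (?\<chi> x) \<le> 1" by (simp add: indicator_def)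
      ultimately have "norm (?P N x) \<le> 2" using norm_triangle_sub[of "?P N x" "?\<chi> x"] by linarith
      then show "norm (h x * ?P N x) \<le> norm (h x) * 2" by (simp add: norm_mult mult_left_mono)
    qed
    have conv: "(\<lambda>N. ?P N x) \<longlonglongrightarrow> ?\<chi> x" if x: "0 < x" "x < 1" "x \<noteq> b" for x
    proof -
      define \<eta> where "\<eta> = min \<bar>x - b\<bar> (min x (1 - x))"
      have \<eta>: "\<eta> > 0" "\<eta> \<le> \<bar>x - b\<bar>" "\<eta> \<le> x" "\<eta> \<le> 1 - x" using x by (auto simp: \<eta>_def)
      have le: "norm (?P N x - ?\<chi> x) \<le> 5 / (2 * (2 * \<eta>)\<^sup>2) / real (Suc N)" for N
      proof -
        have "norm (?P N x - ?\<chi> x) \<le>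
            (LINT s|torus. jackson (Suc N) (x - s) * ((sin (pi * (x - s)))\<^sup>2 / (2 * \<eta>)\<^sup>2))"
        proof (rule norm_jackson_mean_minus[OF _ \<chi>])
          show "integrable torus (\<lambda>s. jackson (Suc N) (x - s) * ((sin (pi * (x - s)))\<^sup>2 / (2 * \<eta>)\<^sup>2))"
            using \<eta> by (intro integrable_torus_continuous continuous_intros) auto
          fix s :: real assume s: "s \<in> {0..<1}"
          show "norm (?\<chi> s - ?\<chi> x) \<le> (sin (pi * (x - s)))\<^sup>2 / (2 * \<eta>)\<^sup>2"
          proof (cases "?\<chi> s = ?\<chi> x")
            case False
            then have "s < b \<and> b \<le> x \<or> x < b \<and> b \<le> s"
              by (auto simp: indicator_def split: if_splits)
            then have "2 * \<eta> \<le> \<bar>sin (pi * (x - s))\<bar>"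
              using \<eta> s by (intro two_dist_int_le_abs_sin_pi) auto
            then have "(2 * \<eta>)\<^sup>2 \<le> (sin (pi * (x - s)))\<^sup>2"
              using \<eta> power_mono[of "2 * \<eta>" "\<bar>sin (pi * (x - s))\<bar>" 2] by simp
            then have "1 \<le> (sin (pi * (x - s)))\<^sup>2 / (2 * \<eta>)\<^sup>2"
              using \<eta> by (subst le_divide_eq) simp
            moreover have "norm (?\<chi> s - ?\<chi> x) \<le> 1" by (simp add: indicator_def)
            ultimately show ?thesis by linarith
          qed simp
        qed simp
        also have "\<dots> = (LINT s|torus. jackson (Suc N) (x - s) * (sin (pi * (x - s)))\<^sup>2) / (2 * \<eta>)\<^sup>2"
          by (simp only: times_divide_eq_right integral_divide_zero)
        also have "\<dots> \<le> 5 / (2 * (real (Suc N))\<^sup>2) / (2 * \<eta>)\<^sup>2"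
          by (intro divide_right_mono integral_jackson_sin_square) auto
        also have "\<dots> = 5 / (2 * (2 * \<eta>)\<^sup>2) / (real (Suc N))\<^sup>2" by simp
        also have "\<dots> \<le> 5 / (2 * (2 * \<eta>)\<^sup>2) / real (Suc N)"
          by (intro divide_left_mono) (auto simp: power2_eq_square)
        finally show ?thesis .
      qed
      have "(\<lambda>N. 5 / (2 * (2 * \<eta>)\<^sup>2) / real (Suc N)) \<longlonglongrightarrow> 0"
        using LIMSEQ_Suc[OF lim_const_over_n] by blast
      then have "(\<lambda>N. ?P N x - ?\<chi> x) \<longlonglongrightarrow> 0"
        by (rule Lim_null_comparison[OF always_eventually[OF allI[OF le]]])
      then show ?thesis by (rule LIM_zero_cancel)
    qed
    have "AE x in lebesgue. x \<notin> {0, b::real}"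
      by (rule AE_not_in) (simp add: negligible_iff_null_sets[symmetric])
    then have "AE x in torus. x \<notin> {0, b}"
      by (subst AE_restrict_space_iff) auto
    then show "AE x in torus. (\<lambda>N. h x * ?P N x) \<longlonglongrightarrow> h x * ?\<chi> x"
      using AE_space
    proof eventually_elim
      case (elim x)
      then show ?case by (intro tendsto_mult tendsto_const conv) auto
    qed
  qed
  then show ?thesis unfolding zP using LIMSEQ_unique tendsto_const by metis
qed

text \<open>The integral of \<open>h\<close> vanishes over initial intervals, hence over Borel sets by the
  \<open>\<pi>\<close>-\<open>\<lambda>\<close> theorem, and over Lebesgue sets, as these differ from Borel sets by null sets.\<close>

lemma fourier_uniqueness:
  assumes h: "integrable torus h" and zero: "\<And>n. (LINT x|torus. h x * ee n x) = 0"
  shows "AE x in torus. h x = 0"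
proof -
  define H where "H x = indicator {0..<1} x *\<^sub>R h x" for x
  have H: "integrable lebesgue H"
    using h unfolding H_def[abs_def] by (simp add: integrable_restrict_space)
  have tor: "(LINT x:B|lebesgue. H x) = (LINT x|torus. h x * indicator B x)" for B
    unfolding set_lebesgue_integral_def H_def
    by (subst integral_restrict_space) (auto intro!: Bochner_Integration.integral_cong simp: indicator_def)
  have int: "set_integrable lebesgue B H" if "B \<in> sets lebesgue" for B
    using integrable_mult_indicator[OF that H] by (simp add: set_integrable_def)
  have total: "(LINT x:UNIV|lebesgue. H x) = 0" unfolding tor using zero[of 0] by simp
  have sb: "sigma_sets UNIV (range (\<lambda>a::real. {..<a})) = sets borel"
    unfolding borel_Iio by (simp add: sets_measure_of)
  have borel: "(LINT x:B|lebesgue. H x) = 0" if "B \<in> sets borel" for B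
  proof -
    have "Int_stable (range (\<lambda>a::real. {..<a}))"
    proof -
      have "{..<a} \<inter> {..<b} = {..<min a b}" for a b :: real by auto
      then show ?thesis by (auto simp: Int_stable_def)
    qed
    moreover have "range (\<lambda>a::real. {..<a}) \<subseteq> Pow UNIV" by simp
    moreover have "B \<in> sigma_sets UNIV (range (\<lambda>a::real. {..<a}))"
      using that unfolding sb .
    ultimately show ?thesis
    proof (induction rule: sigma_sets_induct_disjoint)
      case (basic A)
      then obtain a where a: "A = {..<a}" by auto
      consider "a \<le> 0" | "0 < a" "a < 1" | "a \<ge> 1" by linarith
      then show ?case
      proof cases
        case 1
        have "(LINT x|torus. h x * indicator A x) = (LINT x|torus. 0)"
          by (rule Bochner_Integration.integral_cong) (use 1 a in \<open>auto simp: indicator_def\<close>)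
        then show ?thesis unfolding tor by simp
      next
        case 2
        then show ?thesis unfolding tor a by (rule integral_initial_interval[OF h zero])
      next
        case 3
        have "(LINT x|torus. h x * indicator A x) = (LINT x|torus. h x * ee 0 x)"
          by (rule Bochner_Integration.integral_cong) (use 3 a in \<open>auto simp: indicator_def\<close>)
        then show ?thesis unfolding tor zero .
      qed
    next
      case empty
      show ?case by (simp add: set_lebesgue_integral_def)
    next
      case (compl A)
      have A: "A \<in> sets lebesgue" "UNIV - A \<in> sets lebesgue"
        using compl(1) unfolding sb by (auto intro!: sets_completionI_sets)
      have "(LINT x:(A \<union> (UNIV - A))|lebesgue. H x) = (LINT x:A|lebesgue. H x) + (LINT x:(UNIV - A)|lebesgue. H x)"
        by (rule set_integral_Un) (auto intro!: int A)
      moreover have "A \<union> (UNIV - A) = UNIV" by auto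
      ultimately show ?case using compl total by simp
    next
      case (union A)
      have A: "A i \<in> sets lebesgue" for i
        using union(2) unfolding sb by (auto intro!: sets_completionI_sets)
      have "(LINT x:(\<Union>i. A i)|lebesgue. H x) = (\<Sum>i. LINT x:(A i)|lebesgue. H x)"
        by (rule lebesgue_integral_countable_add)
          (use union(1) A in \<open>auto simp: disjoint_family_on_def intro!: int\<close>)
      then show ?case by (simp add: union)
    qed
  qed
  show ?thesis
  proof (rule sigma_finite_measure.density_zero[OF finite_measure.axioms(1)[OF finite_measure_torus] h])
    fix A :: "real set" assume "A \<in> sets torus"
    then have Aleb: "A \<in> sets lebesgue" by (simp add: sets_restrict_space_iff)
    then obtain S N N' where A: "A = S \<union> N" and S: "S \<in> sets lborel" and N: "N' \<in> null_sets lborel" "N \<subseteq> N'"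
      by (auto elim: sets_completionE)
    have "AE x in lebesgue. x \<notin> N'"
      using AE_not_in[OF N(1)] by (rule AE_completion)
    then have "AE x in lebesgue. (x \<in> A) = (x \<in> S)"
      by eventually_elim (use A N in auto)
    then have "(LINT x:A|lebesgue. H x) = (LINT x:S|lebesgue. H x)"
      using Aleb S H
      by (intro set_integral_cong_set) (auto simp: set_borel_measurable_def intro!: borel_measurable_scaleR borel_measurable_indicator)
    then have "(LINT x:A|lebesgue. H x) = 0" using borel S by simp
    moreover have "(LINT x:A|torus. h x) = (LINT x|torus. h x * indicator A x)"
      unfolding set_lebesgue_integral_def
      by (intro Bochner_Integration.integral_cong) (auto simp: indicator_def)
    ultimately show "(LINT x:A|torus. h x) = 0" unfolding tor by simp
  qed
qed

section \<open>The lower bound\<close>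

text \<open>At powers of two the dilated cutoffs only take the value \<open>1\<close>, when the argument is at most \<open>1\<close>,
  and the value \<open>0\<close>, when it is at least \<open>2\<close>; their consecutive differences vanish except at
  \<open>k = m\<close>.\<close>

lemma LP_multiplier_power_two:
  assumes "admissible_cutoff \<Phi>"
  shows "LP_multiplier \<Phi> k (2 ^ m) = (if k = m then 1 else 0)"
proof -
  note \<Phi> = admissible_cutoffD[OF assms]
  have one: "\<Phi> (2 ^ m / 2 ^ j) = 1" if "m \<le> j" for j
    by (rule \<Phi>(1)) (use that in \<open>simp add: divide_le_eq power_increasing\<close>)
  have zero: "\<Phi> (2 ^ m / 2 ^ j) = 0" if "j < m" for j
  proof (rule \<Phi>(2))
    have "(2::real) * 2 ^ j \<le> 2 ^ m" using power_increasing[of "Suc j" m "2::real"] that by simp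
    then show "2 \<le> \<bar>2 ^ m / 2 ^ j :: real\<bar>" by (simp add: le_divide_eq)
  qed
  show ?thesis
  proof (cases k)
    case 0
    then show ?thesis using one[of 0] zero[of 0] by (cases m) auto
  next
    case (Suc j)
    consider "m \<le> j" | "m = Suc j" | "m > Suc j" by linarith
    then show ?thesis using Suc one[of j] one[of "Suc j"] zero[of j] zero[of "Suc j"] by cases auto
  qed
qed

definition lacunary_sum :: "real \<Rightarrow> nat \<Rightarrow> real \<Rightarrow> complex" where
  "lacunary_sum q K x = (\<Sum>k<K. of_real (real K powr (- (1 / q))) * ee (2 ^ k) x)"

definition lacunary_distribution :: "real \<Rightarrow> nat \<Rightarrow> (real \<Rightarrow> complex) \<Rightarrow> complex" where
  "lacunary_distribution q K \<psi> = (LINT x|torus. lacunary_sum q K x * \<psi> x)"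

lemma integrable_lacunary_sum: "integrable torus (lacunary_sum q K)"
  unfolding lacunary_sum_def[abs_def] by (rule integrable_tsum)

lemma periodic_distribution_lacunary: "periodic_distribution (lacunary_distribution q K)"
proof -
  let ?f = "lacunary_sum q K"
  have cf: "continuous_on S ?f" for S unfolding lacunary_sum_def[abs_def] by (rule continuous_on_tsum)
  have ct: "continuous_on S \<psi>" if "test_function \<psi>" for \<psi> S
    using smooth_continuous_on[of \<psi> S 0] that by (simp add: test_function_def)
  have int: "integrable torus (\<lambda>x. ?f x * \<psi> x)" if "test_function \<psi>" for \<psi>
    by (intro integrable_torus_continuous continuous_intros cf ct that)
  have "norm (lacunary_distribution q K \<psi>) \<le>
      (LINT x|torus. norm (?f x)) * (\<Sum>j\<le>0. SUP x. norm (nth_vector_deriv j \<psi> x))" if \<psi>: "test_function \<psi>" for \<psi>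
  proof -
    obtain B where B: "\<And>x. norm (\<psi> x) \<le> B" using test_function_bounded[OF \<psi>, of 0] by auto
    have "norm (\<psi> x) \<le> (SUP x. norm (\<psi> x))" for x
      by (rule cSUP_upper) (auto intro!: bdd_aboveI2[where M = B] B)
    from integrable_mult_bounded(2)[OF integrable_lacunary_sum test_function_measurable[OF \<psi>] this]
    show ?thesis by (simp add: lacunary_distribution_def)
  qed
  then show ?thesis
    unfolding periodic_distribution_def
    by (intro conjI exI[of _ "LINT x|torus. norm (?f x)"] exI[of _ 0])
      (auto simp: lacunary_distribution_def distrib_left int mult.left_commute)
qed

lemma LP_block_lacunary:
  assumes \<Phi>: "admissible_cutoff \<Phi>"
  shows "LP_block \<Phi> k (lacunary_distribution q K) x =
    (if k < K then of_real (real K powr (- (1 / q))) * ee (2 ^ k) x else 0)"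
proof -
  let ?c = "complex_of_real (real K powr (- (1 / q)))"
  let ?A = "{n. LP_multiplier \<Phi> k (of_int n) \<noteq> 0}"
  have fin: "finite ?A" by (rule LP_block_eq_sum(2)[OF \<Phi>])
  have fc: "fourier_coeff (lacunary_distribution q K) n = (\<Sum>m<K. ?c * (if 2 ^ m = n then 1 else 0))" for n
    using tcoeff_sum[of "{..<K}" "\<lambda>_. ?c" "\<lambda>m. 2 ^ m" n]
    by (simp add: fourier_coeff_ee lacunary_distribution_def tcoeff_def lacunary_sum_def)
  have "LP_block \<Phi> k (lacunary_distribution q K) x =
      (\<Sum>n\<in>?A. \<Sum>m<K. if n = 2 ^ m then of_real (LP_multiplier \<Phi> k (of_int n)) * ?c * ee n x else 0)"
    unfolding LP_block_eq_sum(1)[OF \<Phi>] fc sum_distrib_left sum_distrib_right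
    by (intro sum.cong refl) auto
  also have "\<dots> = (\<Sum>m<K. \<Sum>n\<in>?A. if n = 2 ^ m then of_real (LP_multiplier \<Phi> k (of_int n)) * ?c * ee n x else 0)"
    by (rule sum.swap)
  also have "\<dots> = (\<Sum>m<K. if k = m then ?c * ee (2 ^ k) x else 0)"
    by (intro sum.cong refl) (auto simp: sum.delta[OF fin] LP_multiplier_power_two[OF \<Phi>])
  finally show ?thesis by simp
qed

lemma lacunary_unit_ball:
  assumes \<Phi>: "admissible_cutoff \<Phi>" and q: "1 \<le> q" and K: "K \<ge> 1"
  shows "lacunary_distribution q K \<in> besov_space \<Phi> q"
    and "besov_norm \<Phi> q (lacunary_distribution q K) \<le> 1"
proof -
  have "LP_block_norm \<Phi> k (lacunary_distribution q K) = (if k < K then real K powr (- (1 / q)) else 0)" for k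
    unfolding LP_block_norm_def LP_block_lacunary[OF \<Phi>] by (simp add: norm_mult)
  moreover have "(real K powr (- (1 / q))) powr q = 1 / real K"
    using q K by (simp only: powr_powr) (simp add: powr_minus_divide)
  ultimately have N: "LP_block_norm \<Phi> k (lacunary_distribution q K) powr q = (if k < K then 1 / real K else 0)" for k
    by simp
  have s: "(\<lambda>k. LP_block_norm \<Phi> k (lacunary_distribution q K) powr q) sums (\<Sum>k<K. 1 / real K)"
    using sums_If_finite_set[of "{..<K}" "\<lambda>_. 1 / real K"] unfolding N by simp
  then show "lacunary_distribution q K \<in> besov_space \<Phi> q"
    using periodic_distribution_lacunary by (auto simp: besov_space_def summable_def)
  show "besov_norm \<Phi> q (lacunary_distribution q K) \<le> 1"
    using sums_unique[OF s] K by (simp add: besov_norm_def)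
qed

text \<open>The rearrangement of the distribution is an infimum over all functions that represent it, so
  largeness of the sum itself has to be transferred to each of them.\<close>

lemma growth_envelope_ge:
  assumes \<Phi>: "admissible_cutoff \<Phi>" and q: "1 \<le> q" and K: "K \<ge> 1"
    and E: "E \<in> sets lebesgue" "E \<subseteq> {0..<1}" "ennreal t < emeasure lebesgue E"
    and large: "\<And>x. x \<in> E \<Longrightarrow> a \<le> norm (lacunary_sum q K x)"
  shows "ennreal a \<le> growth_envelope \<Phi> q t"
proof -
  let ?u = "lacunary_distribution q K"
  have "ennreal a \<le> distr_rearrangement ?u t"
    unfolding distr_rearrangement_def decr_rearrangement_def
  proof (intro INF_greatest)
    fix g s assume "g \<in> {f. represents f ?u}"
      and s: "s \<in> {s. 0 \<le> s \<and> emeasure lebesgue {x \<in> {0..<1}. s < norm (g x)} \<le> ennreal t}"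
    then have g: "integrable torus g" and rep: "\<And>\<psi>. test_function \<psi> \<Longrightarrow> ?u \<psi> = (LINT x|torus. g x * \<psi> x)"
      by (auto simp: represents_def set_integral_torus)
    have "AE x in torus. lacunary_sum q K x - g x = 0"
    proof (rule fourier_uniqueness)
      show "integrable torus (\<lambda>x. lacunary_sum q K x - g x)"
        by (intro Bochner_Integration.integrable_diff integrable_lacunary_sum g)
      show "(LINT x|torus. (lacunary_sum q K x - g x) * ee n x) = 0" for n
        using rep[OF test_function_ee, of n]
        by (simp add: left_diff_distrib lacunary_distribution_def integrable_mult_ee integrable_lacunary_sum g)
    qed
    then have eq: "AE x in lebesgue. x \<in> {0..<1} \<longrightarrow> lacunary_sum q K x = g x"
      by (subst (asm) AE_restrict_space_iff) auto
    show "ennreal a \<le> ennreal s"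
    proof (rule ccontr)
      assume "\<not> ?thesis"
      then have "s < a" using s by (auto simp: not_le ennreal_less_iff)
      have "{x \<in> space torus. s < norm (g x)} \<in> sets torus"
        using borel_measurable_integrable[OF g] by measurable
      then have meas: "{x \<in> {0..<1}. s < norm (g x)} \<in> sets lebesgue"
        by (simp add: sets_restrict_space_iff)
      have "emeasure lebesgue E \<le> emeasure lebesgue {x \<in> {0..<1}. s < norm (g x)}"
      proof (rule emeasure_mono_AE[OF _ meas])
        show "AE x in lebesgue. x \<in> E \<longrightarrow> x \<in> {x \<in> {0..<1}. s < norm (g x)}"
          using eq
        proof eventually_elim
          case (elim x)
          then show ?case using E(2) large[of x] \<open>s < a\<close> by (auto simp: subset_eq)
        qed
      qed
      also have "\<dots> \<le> ennreal t" using s by blast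
      finally show False using E(3) by (rule leD[THEN notE])
    qed
  qed
  also have "\<dots> \<le> growth_envelope \<Phi> q t"
    unfolding growth_envelope_def
    using lacunary_unit_ball[OF \<Phi> q K] by (intro SUP_upper) auto
  finally show ?thesis .
qed

lemma norm_lacunary_sum_1: "norm (lacunary_sum q 1 x) = 1"
  by (simp add: lacunary_sum_def)

text \<open>On this interval all phases \<open>2 * pi * 2 ^ k * x\<close> with \<open>k < K\<close> lie in \<open>[0, pi / 3]\<close>, where the cosine
  is at least \<open>1 / 2\<close>.\<close>

lemma norm_lacunary_sum_ge:
  assumes K: "K \<ge> 1" and x: "0 \<le> x" "x \<le> (1 / 2) ^ K / 3"
  shows "real K powr (1 - 1 / q) / 2 \<le> norm (lacunary_sum q K x)"
proof -
  have "1 / 2 \<le> Re (ee (2 ^ k) x)" if k: "k < K" for k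
  proof -
    have "(2::real) ^ k * x \<le> 2 ^ (K - 1) * ((1 / 2) ^ K / 3)"
      using k x by (intro mult_mono power_increasing) auto
    also have "\<dots> = 1 / 6" using K by (cases K) (auto simp: power_one_over)
    finally have "2 * pi * (2 ^ k * x) \<le> 2 * pi * (1 / 6)" by (intro mult_left_mono) auto
    then have "cos (pi / 3) \<le> cos (2 * pi * (2 ^ k * x))"
      using x by (intro cos_monotone_0_pi_le) auto
    then show ?thesis by (simp add: ee_def cos_60 mult.assoc)
  qed
  then have "real K powr (- (1 / q)) * (\<Sum>k<K. 1 / 2) \<le> real K powr (- (1 / q)) * (\<Sum>k<K. Re (ee (2 ^ k) x))"
    by (intro mult_left_mono sum_mono) auto
  also have "\<dots> = Re (lacunary_sum q K x)" by (simp add: lacunary_sum_def sum_distrib_left)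
  also have "\<dots> \<le> norm (lacunary_sum q K x)" by (rule complex_Re_le_cmod)
  finally show ?thesis using K powr_add[of "real K" 1 "- (1 / q)"] by (simp add: mult.commute)
qed

text \<open>For \<open>\<bar>ln t\<bar> < 4\<close> the claim is that the envelope is bounded below by a constant, and a single
  exponential suffices.  Otherwise \<open>K\<close> is about \<open>\<bar>ln t\<bar> / 2\<close>: the interval of length
  \<open>2 ^ (- K) / 3 \<ge> exp (- \<bar>ln t\<bar> / 2) / 3\<close> is then longer than \<open>t\<close>.\<close>

lemma le_growth_envelope:
  assumes \<Phi>: "admissible_cutoff \<Phi>" and q: "1 \<le> q" and t: "0 < t" "t \<le> 1 / 2"
  shows "ennreal (1 / 8 * \<bar>ln t\<bar> powr (1 - 1 / q)) \<le> growth_envelope \<Phi> q t"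
proof -
  define L where "L = \<bar>ln t\<bar>"
  define e where "e = 1 - 1 / q"
  have e: "0 \<le> e" "e \<le> 1" using q by (auto simp: e_def)
  have "ln t < 0" using t by (intro ln_less_zero) auto
  then have tL: "t = exp (- L)" and L: "L > 0" using t by (auto simp: L_def)
  show ?thesis
  proof (cases "L \<ge> 4")
    case False
    have "L powr e \<le> 4 powr e" using False L e by (intro powr_mono2) auto
    also have "\<dots> \<le> 4 powr 1" using e by (intro powr_mono) auto
    finally have "ennreal (1 / 8 * L powr e) \<le> ennreal 1" by (intro ennreal_leI) simp
    also have "\<dots> \<le> growth_envelope \<Phi> q t"
    proof (rule growth_envelope_ge[OF \<Phi> q, of 1 "{0..<1}"])
      show "ennreal t < emeasure lebesgue {0..<1::real}" using t by (simp add: ennreal_less_one_iff)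
    qed (simp_all add: norm_lacunary_sum_1[unfolded One_nat_def])
    finally show ?thesis by (simp add: L_def e_def)
  next
    case True
    define K where "K = nat \<lfloor>L / 2\<rfloor>"
    have K: "real K \<le> L / 2" "L / 4 \<le> real K" "K \<ge> 1"
      using True unfolding K_def by linarith+
    have "ennreal (1 / 8 * L powr e) \<le> ennreal (real K powr e / 2)"
    proof (rule ennreal_leI)
      have "1 / 4 * L powr e \<le> (1 / 4) powr e * L powr e"
        using powr_mono'[OF e(2), of "1/4"] by (intro mult_right_mono) auto
      also have "\<dots> = (L / 4) powr e" using L by (simp flip: powr_mult)
      also have "\<dots> \<le> real K powr e" using K L e by (intro powr_mono2) auto
      finally show "1 / 8 * L powr e \<le> real K powr e / 2" by simp
    qed
    also have "\<dots> \<le> growth_envelope \<Phi> q t"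
    proof (rule growth_envelope_ge[OF \<Phi> q K(3), of "{0..(1 / 2) ^ K / 3}"])
      have "(1 / 2 :: real) ^ K \<le> 1" by (rule power_le_one) auto
      then show "{0..(1 / 2) ^ K / 3} \<subseteq> {0..<1::real}" by auto
      show "real K powr e / 2 \<le> norm (lacunary_sum q K x)" if "x \<in> {0..(1 / 2) ^ K / 3}" for x
        unfolding e_def by (rule norm_lacunary_sum_ge[OF K(3)]) (use that in auto)
      have "3 * t < exp 2 * exp (- L)"
        using four_le_exp_2 unfolding tL by (intro mult_strict_right_mono) auto
      also have "\<dots> \<le> exp (- real K)"
        using True K by (simp flip: exp_add)
      also have "\<dots> = (exp (- 1)) ^ K" by (simp flip: exp_of_nat_mult)
      also have "\<dots> \<le> (1 / 2) ^ K"
        using exp_ge_add_one_self[of 1] by (intro power_mono) (auto simp: exp_minus field_simps)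
      finally show "ennreal t < emeasure lebesgue {0..(1 / 2) ^ K / 3 :: real}"
        using t by (simp add: ennreal_less_iff)
    qed simp
    finally show ?thesis by (simp add: L_def e_def)
  qed
qed

theorem corollary1p2:
  fixes \<Phi> :: "real \<Rightarrow> real" and q :: real
  assumes "admissible_cutoff \<Phi>" and "1 \<le> q" and "q \<le> 2"
  shows "\<exists>c C :: real. 0 < c \<and> c \<le> C \<and>
    (\<forall>t :: real. 0 < t \<and> t \<le> 1 / 2 \<longrightarrow>
       ennreal (c * \<bar>ln t\<bar> powr (1 - 1 / q)) \<le> growth_envelope \<Phi> q t \<and>
       growth_envelope \<Phi> q t \<le> ennreal (C * \<bar>ln t\<bar> powr (1 - 1 / q)))"
  using le_growth_envelope[OF assms(1,2)] growth_envelope_le[OF assms]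
  by (intro exI[of _ "1 / 8"] exI[of _ 88036]) auto

end
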